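(* Let $G$ be a directed multigraph with no self-loops, $k$ a positive integer, and let $G'$, $n_{\mathrm{new}}$, $m_{\mathrm{new}}$, $p$, $L$, $R$, $\tilde L$, $\tilde R$ be as described below. Then with probability at least $1-5/m_{\mathrm{new}}$, the matrix $I-RL$ is invertible and, setting $M=\tilde L(I-RL)^{-1}\tilde R$, for every pair $(s,t)$ of original vertices we have \[\operatorname{rank} M[\operatorname{E_{out}}(s),\operatorname{E_{in}}(t)]=\min(k,\lambda_G(s,t)),\] where $\operatorname{E_{out}}(s)$ and $\operatorname{E_{in}}(t)$ are taken in $G'$. (That is, the algorithm which computes $(I-RL)^{-1}$, then $M$, then outputs these ranks, correctly solves $k$-APC on $G$ with this probability.)
   Context: $\lambda_G(s,t)$ is the maximum number of pairwise edge-disjoint paths from $s$ to $t$ in $G$; the $k$-APC problem asks for $\min(k,\lambda_G(s,t))$ for all pairs $(s,t)$. Let $G$ have $n$ vertices (the original vertices) and $m$ edges. The graph $G'$ is obtained from $G$ as follows: for each vertex $v$ add two new vertices $v_{\mathrm{out}}$ and $v_{\mathrm{in}}$; replace each edge $(u,v)$ of $G$ by an edge $(u_{\mathrm{out}},v_{\mathrm{in}})$; and for each vertex $v$ add $k$ parallel edges from $v$ to $v_{\mathrm{out}}$ and $k$ parallel edges from $v_{\mathrm{in}}$ to $v$. So $G'$ has $n_{\mathrm{new}}=3n$ vertices and $m_{\mathrm{new}}=m+2kn$ edges. In $G'$, $\operatorname{E_{out}}(s)$ is the set of edges leaving $s$ and $\operatorname{E_{in}}(t)$ the set of edges entering $t$;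 for an edge $e=(u,v)$, $u$ is the tail and $v$ the head. Let $p$ be a prime with $p\ge 2m_{\mathrm{new}}^5$ ($p=\Theta(m_{\mathrm{new}}^5)$). For each $i\in[k]$, $L_i$ is an $m_{\mathrm{new}}\times n_{\mathrm{new}}$ matrix over $\mathbb{F}_p$ (rows indexed by edges of $G'$, columns by vertices of $G'$) with $L_i[e,v]$ an independent uniform random element of $\mathbb{F}_p$ for each edge $e=(u,v)$ of $G'$ and all other entries $0$; $R_i$ is an $n_{\mathrm{new}}\times m_{\mathrm{new}}$ matrix with $R_i[u,f]$ an independent uniform random element of $\mathbb{F}_p$ for each edge $f=(u,v)$ of $G'$ and all other entries $0$; all entries are mutually independent. $L$ is the horizontal concatenation of $L_1,\dots,L_k$ and $R$ the vertical concatenation of $R_1,\dots,R_k$. $\tilde L$ is the $kn\times kn_{\mathrm{new}}$ matrix obtained by vertically concatenating $L[\operatorname{E_{out}}(s),\ast]$ over all original vertices $s$, and $\tilde R$ is the $kn_{\mathrm{new}}\times kn$ matrix obtained by horizontally concatenating $R[\ast,\operatorname{E_{in}}(t)]$ over all original vertices $t$; rows/columns of $M$ are thereby indexed by edges in these sets. $A[S,T]$ denotes the submatrix with rows in $S$ and columns in $T$. *)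

theory Defs
  imports
    "HOL-Probability.Probability"
    "Graph_Theory.Graph_Theory"
    "Jordan_Normal_Form.Gauss_Jordan_Elimination"
    "Jordan_Normal_Form.DL_Rank"
    "Jordan_Normal_Form.DL_Submatrix"
    "Berlekamp_Zassenhaus.Finite_Field"
begin

section \<open>Edge connectivity\<close>

text \<open>
  A path from \<open>s\<close> to \<open>t\<close> is always nonempty. For \<open>s \<noteq> t\<close> this is the simple directed path of
  \<^const>\<open>pre_digraph.apath\<close>. For \<open>s = t\<close> the empty path is disregarded (it would be edge-disjoint
  from every path, itself included), so a path from \<open>s\<close> to \<open>s\<close> is a simple directed cycle
  that starts and ends at \<open>s\<close>, exactly as in \<^const>\<open>pre_digraph.cycle\<close>.
\<close>

definition st_path :: "('v,'e) pre_digraph \<Rightarrow> 'v \<Rightarrow> 'e awalk \<Rightarrow> 'v \<Rightarrow> bool" where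
  "st_path G s p t \<longleftrightarrow>
     (if s = t
      then pre_digraph.awalk G s p s \<and> distinct (tl (pre_digraph.awalk_verts G s p)) \<and> p \<noteq> []
      else pre_digraph.apath G s p t)"

text \<open>
  In a finite digraph the set below is finite: pairwise edge-disjoint nonempty
  paths are at most as many as there are edges.
\<close>

definition edge_connectivity :: "('v,'e) pre_digraph \<Rightarrow> 'v \<Rightarrow> 'v \<Rightarrow> nat" where
  "edge_connectivity G s t =
     Max {card P | P. finite P \<and> (\<forall>p\<in>P. st_path G s p t) \<and>
                      pairwise (\<lambda>p q. set p \<inter> set q = {}) P}"

section \<open>The auxiliary graph\<close>

datatype 'v split_vertex = Orig 'v | Out 'v | In 'v

datatype ('v,'e) split_arc =
    Old_Arc 'e          \<comment> \<open>\<open>(u\<^sub>o\<^sub>u\<^sub>t, v\<^sub>i\<^sub>n)\<close> for an edge \<open>(u, v)\<close>\<close>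
  | To_Out 'v nat       \<comment> \<open>the parallel edges from \<open>v\<close> to \<open>v\<^sub>o\<^sub>u\<^sub>t\<close>\<close>
  | From_In 'v nat      \<comment> \<open>the parallel edges from \<open>v\<^sub>i\<^sub>n\<close> to \<open>v\<close>\<close>

definition split_graph ::
    "nat \<Rightarrow> ('v,'e) pre_digraph \<Rightarrow> ('v split_vertex, ('v,'e) split_arc) pre_digraph" where
  "split_graph k G =
     \<lparr> verts = Orig ` verts G \<union> Out ` verts G \<union> In ` verts G,
       arcs = Old_Arc ` arcs G \<union> {To_Out v j | v j. v \<in> verts G \<and> j < k}
                \<union> {From_In v j | v j. v \<in> verts G \<and> j < k},
       tail = (\<lambda>a. case a of Old_Arc e \<Rightarrow> Out (tail G e) | To_Out v j \<Rightarrow> Orig v | From_In v j \<Rightarrow> In v),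
       head = (\<lambda>a. case a of Old_Arc e \<Rightarrow> In (head G e) | To_Out v j \<Rightarrow> Out v | From_In v j \<Rightarrow> Orig v) \<rparr>"

lemma split_graph_fin_digraph:
  assumes "fin_digraph G"
  shows "fin_digraph (split_graph k G)"
proof -
  interpret fin_digraph G by fact
  have "finite {c v j | v j. v \<in> verts G \<and> j < k}" for c :: "'a \<Rightarrow> nat \<Rightarrow> ('a,'b) split_arc"
    by (rule finite_subset[of _ "case_prod c ` (verts G \<times> {..<k})"]) auto
  then show ?thesis
    by unfold_locales (auto simp: split_graph_def)
qed

lemma card_verts_split_graph:
  assumes "fin_digraph G"
  shows "card (verts (split_graph k G)) = 3 * card (verts G)"
proof -
  interpret fin_digraph G by fact
  have "card (Orig ` verts G \<union> Out ` verts G \<union> In ` verts G)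
      = card (Orig ` verts G) + card (Out ` verts G) + card (In ` verts G)"
    by (subst card_Un_disjoint; (subst card_Un_disjoint)?) auto
  then show ?thesis by (simp add: split_graph_def card_image inj_on_def)
qed

lemma card_arcs_split_graph:
  fixes G :: "('v,'e) pre_digraph"
  assumes "fin_digraph G"
  shows "card (arcs (split_graph k G)) = card (arcs G) + 2 * k * card (verts G)"
proof -
  interpret fin_digraph G by fact
  define A :: "('v,'e) split_arc set" where "A = case_prod To_Out ` (verts G \<times> {..<k})"
  define B :: "('v,'e) split_arc set" where "B = case_prod From_In ` (verts G \<times> {..<k})"
  define C :: "('v,'e) split_arc set" where "C = Old_Arc ` arcs G"
  have arcs: "arcs (split_graph k G) = C \<union> A \<union> B"
    by (auto simp: split_graph_def A_def B_def C_def)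
  have "card A = card (verts G) * k" "card B = card (verts G) * k" "card C = card (arcs G)"
    unfolding A_def B_def C_def by (subst card_image; auto simp: inj_on_def)+
  moreover have "card (C \<union> A \<union> B) = card C + card A + card B"
    by (subst card_Un_disjoint; (subst card_Un_disjoint)?) (auto simp: A_def B_def C_def)
  ultimately show ?thesis by (simp add: arcs)
qed

section \<open>The random matrices\<close>

text \<open>
  The vertices and edges of a digraph \<open>H\<close> index rows and columns through enumerations \<open>vs\<close>
  and \<open>es\<close>. A sample is a function \<open>x\<close>: \<open>x (Inl (i, e))\<close> is the entry of \<open>L\<^sub>i\<close> in row \<open>e\<close>,
  column \<open>head H e\<close>, and \<open>x (Inr (i, e))\<close> is the entry of \<open>R\<^sub>i\<close> in row \<open>tail H e\<close>, column \<open>e\<close>.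
\<close>

type_synonym ('e,'a) sample = "(nat \<times> 'e) + (nat \<times> 'e) \<Rightarrow> 'a"

definition random_sample :: "('v,'e) pre_digraph \<Rightarrow> nat \<Rightarrow> ('e, 'p::prime_card mod_ring) sample pmf" where
  "random_sample H k =
     Pi_pmf (({..<k} \<times> arcs H) <+> ({..<k} \<times> arcs H)) 0 (\<lambda>_. pmf_of_set UNIV)"

definition L_block ::
    "('v,'e) pre_digraph \<Rightarrow> 'v list \<Rightarrow> 'e list \<Rightarrow> ('e,'a::zero) sample \<Rightarrow> nat \<Rightarrow> 'a mat" where
  "L_block H vs es x i = mat (length es) (length vs)
     (\<lambda>(a,b). if head H (es ! a) = vs ! b then x (Inl (i, es ! a)) else 0)"

definition R_block ::
    "('v,'e) pre_digraph \<Rightarrow> 'v list \<Rightarrow> 'e list \<Rightarrow> ('e,'a::zero) sample \<Rightarrow> nat \<Rightarrow> 'a mat" where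
  "R_block H vs es x i = mat (length vs) (length es)
     (\<lambda>(a,b). if tail H (es ! b) = vs ! a then x (Inr (i, es ! b)) else 0)"

definition L_mat ::
    "('v,'e) pre_digraph \<Rightarrow> nat \<Rightarrow> 'v list \<Rightarrow> 'e list \<Rightarrow> ('e,'a::zero) sample \<Rightarrow> 'a mat" where
  "L_mat H k vs es x =
     mat_of_cols (length es) (concat (map (\<lambda>i. cols (L_block H vs es x i)) [0..<k]))"

definition R_mat ::
    "('v,'e) pre_digraph \<Rightarrow> nat \<Rightarrow> 'v list \<Rightarrow> 'e list \<Rightarrow> ('e,'a::zero) sample \<Rightarrow> 'a mat" where
  "R_mat H k vs es x =
     mat_of_rows (length es) (concat (map (\<lambda>i. rows (R_block H vs es x i)) [0..<k]))"

definition positions :: "'b list \<Rightarrow> 'b set \<Rightarrow> nat set" where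
  "positions xs S = {a. a < length xs \<and> xs ! a \<in> S}"

text \<open>
  Below, \<open>us\<close> enumerates the original vertices. The rows of \<open>L_tilde\<close> are indexed by
  \<open>out_order H es us\<close> and the columns of \<open>R_tilde\<close> by \<open>in_order H es us\<close>.
\<close>

definition out_order :: "('v,'e) pre_digraph \<Rightarrow> 'e list \<Rightarrow> 'v list \<Rightarrow> 'e list" where
  "out_order H es us = concat (map (\<lambda>s. filter (\<lambda>e. e \<in> out_arcs H s) es) us)"

definition in_order :: "('v,'e) pre_digraph \<Rightarrow> 'e list \<Rightarrow> 'v list \<Rightarrow> 'e list" where
  "in_order H es us = concat (map (\<lambda>t. filter (\<lambda>e. e \<in> in_arcs H t) es) us)"

definition L_tilde ::
    "('v,'e) pre_digraph \<Rightarrow> nat \<Rightarrow> 'v list \<Rightarrow> 'e list \<Rightarrow> 'v list \<Rightarrow> ('e,'a::zero) sample \<Rightarrow> 'a mat" where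
  "L_tilde H k vs es us x = mat_of_rows (k * length vs)
     (concat (map (\<lambda>s. rows (submatrix (L_mat H k vs es x) (positions es (out_arcs H s)) UNIV)) us))"

definition R_tilde ::
    "('v,'e) pre_digraph \<Rightarrow> nat \<Rightarrow> 'v list \<Rightarrow> 'e list \<Rightarrow> 'v list \<Rightarrow> ('e,'a::zero) sample \<Rightarrow> 'a mat" where
  "R_tilde H k vs es us x = mat_of_cols (k * length vs)
     (concat (map (\<lambda>t. cols (submatrix (R_mat H k vs es x) UNIV (positions es (in_arcs H t)))) us))"

definition I_minus_RL ::
    "('v,'e) pre_digraph \<Rightarrow> nat \<Rightarrow> 'v list \<Rightarrow> 'e list \<Rightarrow> ('e,'a::field) sample \<Rightarrow> 'a mat" where
  "I_minus_RL H k vs es x = 1\<^sub>m (k * length vs) - R_mat H k vs es x * L_mat H k vs es x"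

text \<open>Only meaningful if \<open>I_minus_RL\<close> is invertible.\<close>

definition M_mat ::
    "('v,'e) pre_digraph \<Rightarrow> nat \<Rightarrow> 'v list \<Rightarrow> 'e list \<Rightarrow> 'v list \<Rightarrow> ('e,'a::field) sample \<Rightarrow> 'a mat" where
  "M_mat H k vs es us x =
     L_tilde H k vs es us x * the (mat_inverse (I_minus_RL H k vs es x)) * R_tilde H k vs es us x"

definition M_block ::
    "('v,'e) pre_digraph \<Rightarrow> nat \<Rightarrow> 'v list \<Rightarrow> 'e list \<Rightarrow> 'v list \<Rightarrow> ('e,'a::field) sample
      \<Rightarrow> 'e set \<Rightarrow> 'e set \<Rightarrow> 'a mat" where
  "M_block H k vs es us x S T =
     submatrix (M_mat H k vs es us x) (positions (out_order H es us) S) (positions (in_order H es us) T)"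

definition mat_rank :: "'a::field mat \<Rightarrow> nat" where
  "mat_rank A = vec_space.rank (dim_row A) A"

end

theory Submission
  imports Defs
begin

text \<open>
  If \<open>I - R L\<close> is invertible, with inverse \<open>Y\<close>, then \<open>(I - L R)\<^sup>-\<^sup>1 = I + L Y R\<close>, and by a Schur
  complement a minor \<open>E (L Y R) F\<close> with \<open>E F = 0\<close> is nonzero if and only if the bordered
  determinant of \<open>[I - L R, F; E, 0]\<close> is nonzero.

  Upper bound: a nonzero bordered determinant has a nonzero term in its expansion over the
  permutations. The orbits of that permutation through the border spell out edge-disjoint walks
  from \<open>s\<close> to \<open>t\<close>, as many as the rank. So the rank is at most \<open>\<lambda>(s,t)\<close> whenever \<open>I - R L\<close> is
  invertible, and no max-flow min-cut theorem is needed.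

  Lower bound: \<open>min k \<lambda>(s,t)\<close> edge-disjoint paths yield a sample at which the bordered determinant
  is nonzero, so it vanishes with small probability by a Schwartz-Zippel argument.
\<close>

section \<open>Rank and nonsingular compressions\<close>

text \<open>The entries of \<open>M\<close> are rational functions of the sample. The bordered
  determinant removes the inverse: it is the determinant of a matrix whose entries are polynomials
  of degree at most 2, and it serves both bounds. In the upper bound the borders \<open>E\<close>
  and \<open>F\<close> depend on the sample, because they realise the rank by arbitrary combinations
  of rows and columns; only their supports matter there. In the lower bound the borders are fixed,
  so there is one polynomial per pair and a union bound applies.

  The auxiliary graph enters twice. All edges leaving an original vertex are \<open>To_Out\<close>
  edges and all edges entering one are \<open>From_In\<close> edges, so \<open>E F = 0\<close> even
  for s = t. There are k of each at a vertex, which caps the rank at k.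

  The constant 5: \<open>det (I - R L)\<close> has degree at most 6kn \<le> 3m, and each of the n^2
  bordered determinants has degree at most 2(m + k), where n is the number of original vertices and
  m the number of edges of the auxiliary graph. Together this is at most 3m + 2m^3 \<le> 5m^4, to be
  divided by p - 1 \<ge> m^5.\<close>

lemma (in vec_space) rank_mult_le_left:
  assumes X: "X \<in> carrier_mat n m" and Y: "Y \<in> carrier_mat m l"
  shows "rank (X * Y) \<le> rank X"
proof -
  have XY: "X * Y \<in> carrier_mat n l" using X Y by simp
  have cX: "set (cols X) \<subseteq> carrier_vec n" and cXY: "set (cols (X * Y)) \<subseteq> carrier_vec n"
    using X XY cols_dim by blast+
  have sub: "set (cols (X * Y)) \<subseteq> span (set (cols X))"
  proof
    fix v assume "v \<in> set (cols (X * Y))"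
    then obtain j where j: "j < l" "v = col (X * Y) j"
      using XY by (auto simp: cols_def)
    then have "v = X *\<^sub>v col Y j" using X Y by (metis carrier_matD(2) col_mult2)
    moreover have "col Y j \<in> carrier_vec m" using Y by auto
    ultimately show "v \<in> span (set (cols X))"
      using col_space_eq[OF X] X j XY unfolding col_space_def by auto
  qed
  have 1: "subspace class_ring (span (set (cols X))) V" using cX by (simp add: span_is_subspace)
  have 2: "subspace class_ring (span (set (cols (X * Y)))) V" using cXY by (simp add: span_is_subspace)
  have "span (set (cols (X * Y))) \<subseteq> span (set (cols X))"
    using sub cX by (simp add: span_is_subset span_is_submodule)
  then have 3: "subspace class_ring (span (set (cols (X * Y)))) (vs (span (set (cols X))))"
    using nested_subspaces 1 2 by blast
  have "vectorspace.dim class_ring (vs (span (set (cols (X * Y))))) \<le> vectorspace.dim class_ring (vs (span (set (cols X))))"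
    using vectorspace.subspace_dim[OF subspace_is_vs[OF 1] 3] fin_dim_span_cols[OF X] fin_dim_span_cols[OF XY]
    by simp
  then show ?thesis unfolding rank_def .
qed

lemma det_nonzero_iff_inj:
  fixes A :: "'a::field mat"
  assumes "A \<in> carrier_mat n n"
  shows "det A \<noteq> 0 \<longleftrightarrow> (\<forall>v\<in>carrier_vec n. A *\<^sub>v v = 0\<^sub>v n \<longrightarrow> v = 0\<^sub>v n)"
  using det_0_iff_vec_prod_zero[OF assms] by blast

text \<open>A linear relation among the columns of \<open>A * Q\<close> would give a kernel vector
  of \<open>P * A * Q\<close>. So \<open>A * Q\<close> has full column rank, and its columns lie in
  the column space of \<open>A\<close>.\<close>

lemma rank_ge_of_det_nonzero:
  fixes A :: "'a::field mat"
  assumes A: "A \<in> carrier_mat nr nc" and P: "P \<in> carrier_mat r nr" and Q: "Q \<in> carrier_mat nc r"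
    and det: "det (P * A * Q) \<noteq> 0"
  shows "r \<le> vec_space.rank nr A"
proof -
  interpret vec_space "TYPE('a)" nr .
  have AQ: "A * Q \<in> carrier_mat nr r" using A Q by simp
  have PAQ: "P * A * Q = P * (A * Q)" using P A Q by simp
  have PAQc: "P * A * Q \<in> carrier_mat r r" using P A Q by simp
  \<comment> \<open>Independence is stated for the set of columns, so repeated columns have to be
    excluded first.\<close>
  have dist: "distinct (cols (A * Q))"
  proof (rule ccontr)
    assume "\<not> distinct (cols (A * Q))"
    then obtain i j where ij: "i < r" "j < r" "i \<noteq> j" "col (A * Q) i = col (A * Q) j"
      using AQ by (auto simp: distinct_conv_nth)
    then have "col (P * (A * Q)) i = col (P * (A * Q)) j"
      using P AQ by (metis carrier_matD(2) col_mult2)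
    then show False using det_identical_cols[OF PAQc ij(3,1,2)] det PAQ by simp
  qed
  have "lin_indpt (set (cols (A * Q)))"
  proof
    assume "lin_dep (set (cols (A * Q)))"
    then obtain v where v: "v \<in> carrier_vec r" "v \<noteq> 0\<^sub>v r" "(A * Q) *\<^sub>v v = 0\<^sub>v nr"
      using lin_depE[OF AQ _ dist] by blast
    then have "(P * A * Q) *\<^sub>v v = P *\<^sub>v 0\<^sub>v nr"
      using P AQ PAQ by (metis assoc_mult_mat_vec)
    also have "\<dots> = 0\<^sub>v r" using P by auto
    finally have "(P * A * Q) *\<^sub>v v = 0\<^sub>v r" .
    then show False using det_nonzero_iff_inj[OF PAQc] det v by blast
  qed
  then have "rank (A * Q) = r" using lin_indpt_full_rank[OF AQ dist] by simp
  then show ?thesis using rank_mult_le_left[OF A Q] by simp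
qed

text \<open>Converse of the preceding bound. Take the largest \<open>r\<close> for which some
  compression \<open>P * A * Q\<close> is the identity. If the residual \<open>A - A Q P A\<close>
  had a nonzero entry, the compression could be enlarged by one; so the residual vanishes and
  \<open>A\<close> factors through dimension \<open>r\<close>.\<close>

lemma det_nonzero_of_rank:
  fixes A :: "'a::field mat"
  assumes A: "A \<in> carrier_mat nr nc"
  obtains P Q where "P \<in> carrier_mat (vec_space.rank nr A) nr" "Q \<in> carrier_mat nc (vec_space.rank nr A)"
    "det (P * A * Q) \<noteq> 0"
proof -
  define good where "good r \<longleftrightarrow> (\<exists>P Q. P \<in> carrier_mat r nr \<and> Q \<in> carrier_mat nc r \<and> P * A * Q = 1\<^sub>m r)" for r
  have good_le: "r \<le> vec_space.rank nr A" if "good r" for r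
    using that rank_ge_of_det_nonzero[OF A] unfolding good_def by (metis det_one zero_neq_one)
  have "good 0"
    unfolding good_def by (rule exI[of _ "0\<^sub>m 0 nr"], rule exI[of _ "0\<^sub>m nc 0"]) (use A in auto)
  define r where "r = Greatest good"
  have "good r" unfolding r_def using GreatestI_nat[of good 0] \<open>good 0\<close> good_le by blast
  have r_max: "r' \<le> r" if "good r'" for r'
    unfolding r_def using Greatest_le_nat[of good r' "vec_space.rank nr A"] that good_le by blast
  from \<open>good r\<close> obtain P Q where P: "P \<in> carrier_mat r nr" and Q: "Q \<in> carrier_mat nc r"
    and PAQ: "P * A * Q = 1\<^sub>m r" unfolding good_def by blast
  \<comment> \<open>The part of \<open>A\<close> not captured by the compression: \<open>P\<close>
    annihilates it from the left and \<open>Q\<close> from the right.\<close>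
  define B where "B = A - (A * Q) * (P * A)"
  have Bc: "B \<in> carrier_mat nr nc" using A P Q unfolding B_def by auto
  have "B = 0\<^sub>m nr nc"
  proof (rule ccontr)
    assume "B \<noteq> 0\<^sub>m nr nc"
    then obtain i j where ij: "i < nr" "j < nc" and nz: "B $$ (i,j) \<noteq> 0"
      using Bc by (metis carrier_matD eq_matI index_zero_mat)
    \<comment> \<open>\<open>U\<close> and \<open>W\<close> isolate the nonzero entry of
      \<open>B\<close> and scale it to \<open>U * B * W = 1\<close>.\<close>
    define U where "U = mat 1 nr (\<lambda>(a,b). if b = i then 1 / B $$ (i,j) else (0::'a))"
    define W where "W = mat nc 1 (\<lambda>(a,b). if a = j then (1::'a) else 0)"
    have Uc: "U \<in> carrier_mat 1 nr" and Wc: "W \<in> carrier_mat nc 1" unfolding U_def W_def by auto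
    \<comment> \<open>The projections make the cross terms \<open>u * A * Q\<close> and
      \<open>P * A * w\<close> vanish and turn \<open>u * A * w\<close> into
      \<open>U * B * W\<close>.\<close>
    define u where "u = U * (1\<^sub>m nr - A * Q * P)"
    define w where "w = (1\<^sub>m nc - Q * P * A) * W"
    have uc: "u \<in> carrier_mat 1 nr" and wc: "w \<in> carrier_mat nc 1"
      using Uc Wc A P Q unfolding u_def w_def by auto
    have AQP: "A * Q * P \<in> carrier_mat nr nr" and QPA: "Q * P * A \<in> carrier_mat nc nc"
      using A P Q by auto
    have AQ: "A * Q \<in> carrier_mat nr r" and PA: "P * A \<in> carrier_mat r nc"
      and AQPA: "A * Q * (P * A) \<in> carrier_mat nr nc" and QP: "Q * P \<in> carrier_mat nc nr"
      and QPA': "Q * (P * A) \<in> carrier_mat nc nc" using A P Q by auto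
    note [simp] = A P Q AQ PA AQPA QP QPA' AQP QPA Bc Uc Wc uc wc
    note [simp] = carrier_matD[OF A] carrier_matD[OF Bc] carrier_matD[OF Uc] carrier_matD[OF Wc]
      carrier_matD[OF P] carrier_matD[OF Q] carrier_matD[OF uc] carrier_matD[OF wc]
    have BQ: "B * Q = 0\<^sub>m nr r"
    proof -
      have "B * Q = A * Q - A * Q * (P * A) * Q"
        unfolding B_def by (subst minus_mult_distrib_mat[of _ nr nc _ _ r]) auto
      also have "A * Q * (P * A) * Q = A * Q * (P * A * Q)"
        using A P Q by (simp add: assoc_mult_mat[of _ nr r _ nc _ r])
      finally show ?thesis using A Q PAQ by simp
    qed
    have PB: "P * B = 0\<^sub>m r nc"
    proof -
      have "P * B = P * A - P * (A * Q * (P * A))"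
        unfolding B_def by (subst mult_minus_distrib_mat[of _ r nr _ nc]) auto
      also have "P * (A * Q * (P * A)) = (P * A * Q) * (P * A)"
        using A P Q by (simp add: assoc_mult_mat[of _ r nr _ r _ nc] assoc_mult_mat[of _ r nr _ nc _ r])
      finally show ?thesis using A P PAQ by simp
    qed
    have left: "(1\<^sub>m nr - A * Q * P) * A = B"
      unfolding B_def by (subst minus_mult_distrib_mat[of _ nr nr _ _ nc])
        (simp_all add: assoc_mult_mat[of _ nr r _ nr _ nc] left_mult_one_mat[OF A])
    have right: "A * (1\<^sub>m nc - Q * P * A) = B"
      unfolding B_def by (subst mult_minus_distrib_mat[of _ nr nc _ nc])
        (simp_all add: assoc_mult_mat[of _ nc r _ nr _ nc] assoc_mult_mat[of _ nr nc _ r _ nc]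
          right_mult_one_mat[OF A])
    have uA: "u * A = U * B"
      unfolding u_def left[symmetric] by (rule assoc_mult_mat[OF Uc minus_carrier_mat[OF AQP] A])
    have Aw: "A * w = B * W"
      unfolding w_def right[symmetric] by (rule assoc_mult_mat[OF A minus_carrier_mat[OF QPA] Wc, symmetric])
    have 1: "u * A * Q = 0\<^sub>m 1 r"
      unfolding uA assoc_mult_mat[OF Uc Bc Q] BQ using Uc by simp
    have 2: "P * A * w = 0\<^sub>m r 1"
      unfolding assoc_mult_mat[OF P A wc] Aw assoc_mult_mat[OF P Bc Wc, symmetric] PB
      using Wc by simp
    have "B * (Q * P * A) = 0\<^sub>m nr nc"
      using BQ by (simp add: assoc_mult_mat[OF Q P A] assoc_mult_mat[OF Bc Q PA, symmetric] left_mult_zero_mat[OF PA])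
    moreover have "B - 0\<^sub>m nr nc = B" by (rule eq_matI) (auto simp: carrier_matD[OF Bc])
    ultimately have "B * (1\<^sub>m nc - Q * P * A) = B"
      by (subst mult_minus_distrib_mat[of _ nr nc _ nc]) (auto simp: right_mult_one_mat[OF Bc])
    then have "u * A * w = U * B * W"
      unfolding uA w_def using assoc_mult_mat[of "U * B" 1 nc "1\<^sub>m nc - Q * P * A" nc W 1]
        assoc_mult_mat[OF Uc Bc, of "1\<^sub>m nc - Q * P * A" nc] Uc Bc Wc QPA
      by (metis mult_carrier_mat minus_carrier_mat)
    also have "\<dots> = 1\<^sub>m 1"
    proof (rule eq_matI)
      fix a b assume "a < dim_row (1\<^sub>m 1 :: 'a mat)" "b < dim_col (1\<^sub>m 1 :: 'a mat)"
      then have [simp]: "a = 0" "b = 0" by auto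
      have "(U * B) $$ (0, l) = B $$ (i, l) / B $$ (i, j)" if "l < nc" for l
        using Bc ij that by (simp add: U_def scalar_prod_def if_distrib[of "\<lambda>x. x * _"] cong: if_cong)
      moreover have "(U * B * W) $$ (0,0) = (\<Sum>l = 0..<nc. (U * B) $$ (0,l) * W $$ (l,0))"
        by (subst index_mult_mat) (auto simp: scalar_prod_def simp del: index_mult_mat(1))
      moreover have "(\<Sum>l = 0..<nc. (U * B) $$ (0,l) * W $$ (l,0)) = (\<Sum>l = 0..<nc. if l = j then 1 else 0)"
        by (rule sum.cong) (use calculation nz in \<open>auto simp: W_def simp del: index_mult_mat(1)\<close>)
      ultimately show "(U * B * W) $$ (a, b) = 1\<^sub>m 1 $$ (a, b)"
        using ij by (simp del: index_mult_mat(1))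
    qed (use Uc Wc in auto)
    finally have 3: "u * A * w = 1\<^sub>m 1" .
    \<comment> \<open>Blocks of width or height zero are added so that the product rule for
      four-block matrices can append one row to \<open>P\<close> and one column to
      \<open>Q\<close>.\<close>
    define P' where "P' = four_block_mat P (0\<^sub>m r 0) u (0\<^sub>m 1 0)"
    define Q' where "Q' = four_block_mat Q w (0\<^sub>m 0 r) (0\<^sub>m 0 1)"
    have "A = four_block_mat A (0\<^sub>m nr 0) (0\<^sub>m 0 nc) (0\<^sub>m 0 0)"
      using A by (intro eq_matI) auto
    then have "P' * A = P' * four_block_mat A (0\<^sub>m nr 0) (0\<^sub>m 0 nc) (0\<^sub>m 0 0)" by simp
    also have "\<dots> = four_block_mat (P * A) (0\<^sub>m r 0) (u * A) (0\<^sub>m 1 0)"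
      unfolding P'_def
      by (subst mult_four_block_mat[OF P zero_carrier_mat uc zero_carrier_mat A zero_carrier_mat zero_carrier_mat zero_carrier_mat])
        (intro cong_four_block_mat; rule eq_matI; simp)
    finally have "P' * A = four_block_mat (P * A) (0\<^sub>m r 0) (u * A) (0\<^sub>m 1 0)" .
    then have "P' * A * Q' = four_block_mat (P * A * Q) (P * A * w) (u * A * Q) (u * A * w)"
      unfolding Q'_def
      by (simp only: mult_four_block_mat[OF PA zero_carrier_mat mult_carrier_mat[OF uc A] zero_carrier_mat Q wc zero_carrier_mat zero_carrier_mat])
        (intro cong_four_block_mat; rule eq_matI; simp)
    then have "P' * A * Q' = 1\<^sub>m (Suc r)"
      unfolding PAQ 1 2 3 by (simp add: four_block_one_mat)
    moreover have "P' \<in> carrier_mat (Suc r) nr" "Q' \<in> carrier_mat nc (Suc r)"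
      unfolding P'_def Q'_def using P Q uc wc by auto
    ultimately have "good (Suc r)" unfolding good_def by blast
    then show False using r_max by fastforce
  qed
  then have "A = A * Q * (P * A)"
    unfolding B_def using A P Q
    by (intro eq_matI) (auto dest!: arg_cong[where f="\<lambda>X. X $$ _"] simp: mat_eq_iff)
  then have "vec_space.rank nr A \<le> vec_space.rank nr (A * Q)"
    using vec_space.rank_mult_le_left[of "A * Q" nr r "P * A" nc] A P Q by (metis mult_carrier_mat)
  also have "\<dots> \<le> r" using vec_space.rank_le_nc[of "A * Q" nr r] A Q by simp
  finally have "vec_space.rank nr A = r" using good_le[OF \<open>good r\<close>] by simp
  then show thesis using that P Q PAQ by simp
qed

section \<open>Bordered determinants\<close>

text \<open>With \<open>K = L R\<close> and \<open>Z = L Y R\<close>, the matrix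
  \<open>I + Z\<close> inverts \<open>I - K\<close>. The Schur complement of \<open>I - K\<close> in
  the bordered matrix is therefore \<open>- E (I + Z) F\<close>, and this equals
  \<open>- E Z F\<close> because \<open>E F = 0\<close>.\<close>

lemma det_bordered_iff:
  fixes L R :: "'a::field mat"
  assumes L: "L \<in> carrier_mat m q" and R: "R \<in> carrier_mat q m" and Y: "Y \<in> carrier_mat q q"
    and inv: "(1\<^sub>m q - R * L) * Y = 1\<^sub>m q"
    and E: "E \<in> carrier_mat r m" and F: "F \<in> carrier_mat m r" and EF: "E * F = 0\<^sub>m r r"
  shows "det (four_block_mat (1\<^sub>m m - L * R) F E (0\<^sub>m r r)) \<noteq> 0 \<longleftrightarrow> det (E * (L * Y * R) * F) \<noteq> 0"
proof -
  define K where "K = L * R"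
  define Z where "Z = L * Y * R"
  have K: "K \<in> carrier_mat m m" and Z: "Z \<in> carrier_mat m m" using L R Y unfolding K_def Z_def by auto
  have KZ: "K * Z \<in> carrier_mat m m" and RL: "R * L \<in> carrier_mat q q" and ZF: "Z * F \<in> carrier_mat m r"
    and LY: "L * Y \<in> carrier_mat m q" and RLY: "R * L * Y \<in> carrier_mat q q"
    and KZF: "K * (Z * F) \<in> carrier_mat m r" and EZ: "E * Z \<in> carrier_mat r m"
    and EZF: "E * (Z * F) \<in> carrier_mat r r" using L R Y K Z E F by auto
  have XF: "F + Z * F \<in> carrier_mat m r" using F ZF by auto
  have "Y - R * L * Y = 1\<^sub>m q"
    using inv minus_mult_distrib_mat[OF one_carrier_mat RL Y] left_mult_one_mat[OF Y] by simp
  then have RLY_eq: "R * L * Y = Y - 1\<^sub>m q"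
    using Y RLY unfolding mat_eq_iff by (auto simp: algebra_simps)
  \<comment> \<open>Push-through: \<open>R L Y = Y - I\<close>, multiplied by \<open>L\<close> and
    \<open>R\<close> from outside, becomes \<open>K Z = Z - K\<close>.\<close>
  have "K * Z = L * (R * L * Y) * R"
    unfolding K_def Z_def using L R Y RL by (simp add: assoc_mult_mat[of _ m q _ m _ m] assoc_mult_mat[of _ q m _ q _ m]
        assoc_mult_mat[of _ m q _ q _ m] assoc_mult_mat[of _ q m _ q _ q] assoc_mult_mat[of _ q q _ q _ m])
  also have "\<dots> = (L * Y - L) * R"
    unfolding RLY_eq using mult_minus_distrib_mat[OF L Y one_carrier_mat] right_mult_one_mat[OF L] by simp
  also have "\<dots> = Z - K"
    unfolding K_def Z_def by (rule minus_mult_distrib_mat[OF LY L R])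
  finally have KZ_eq: "K * Z = Z - K" .
  have one: "(1\<^sub>m m - K) * (1\<^sub>m m + Z) = 1\<^sub>m m"
  proof -
    have "(1\<^sub>m m - K) * (1\<^sub>m m + Z) = (1\<^sub>m m - K) + (1\<^sub>m m - K) * Z"
      using mult_add_distrib_mat[OF minus_carrier_mat[OF K] one_carrier_mat Z]
        right_mult_one_mat[OF minus_carrier_mat[OF K]] by simp
    also have "(1\<^sub>m m - K) * Z = Z - K * Z"
      using minus_mult_distrib_mat[OF one_carrier_mat K Z] left_mult_one_mat[OF Z] by simp
    finally show ?thesis unfolding KZ_eq using K Z by (intro eq_matI) auto
  qed
  have "det (1\<^sub>m m - K) * det (1\<^sub>m m + Z) = 1"
    unfolding det_mult[OF minus_carrier_mat[OF K] add_carrier_mat[OF Z], symmetric] one by simp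
  then have det1: "det (1\<^sub>m m - K) \<noteq> 0" by auto
  have EXF: "E * (F + Z * F) = E * (Z * F)"
    using mult_add_distrib_mat[OF E F ZF] EF EZF by simp
  have "(1\<^sub>m m - K) * (F + Z * F) = F"
  proof -
    have "F + Z * F = (1\<^sub>m m + Z) * F"
      using add_mult_distrib_mat[OF one_carrier_mat Z F] F by simp
    then have "(1\<^sub>m m - K) * (F + Z * F) = ((1\<^sub>m m - K) * (1\<^sub>m m + Z)) * F"
      using assoc_mult_mat[OF minus_carrier_mat[OF K] add_carrier_mat[OF Z] F] by simp
    then show ?thesis unfolding one using F by simp
  qed
  \<comment> \<open>The sign of the Schur complement is moved into a separate factor, of which only
    the invertibility is used.\<close>
  moreover define M1 :: "'a mat" where "M1 = (-1) \<cdot>\<^sub>m 1\<^sub>m r"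
  have M1: "M1 \<in> carrier_mat r r" "det M1 \<noteq> 0" unfolding M1_def by auto
  have "M1 * (E * (Z * F)) = - (E * (Z * F))"
    unfolding M1_def using mult_smult_assoc_mat[OF one_carrier_mat EZF, of "-1"] left_mult_one_mat[OF EZF]
    by (simp add: uminus_mat_def smult_mat_def map_mat_def)
  then have "E * (F + Z * F) + M1 * (E * (Z * F)) = 0\<^sub>m r r"
    unfolding EXF using E F by (intro eq_matI) (auto simp del: index_mult_mat(1))
  ultimately have "four_block_mat (1\<^sub>m m - K) F E (0\<^sub>m r r)
      = four_block_mat (1\<^sub>m m - K) (0\<^sub>m m r) E M1 * four_block_mat (1\<^sub>m m) (F + Z * F) (0\<^sub>m r m) (E * (Z * F))"
    using M1 K E F XF EZF EXF minus_carrier_mat[OF K, of "1\<^sub>m m"]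
    by (subst mult_four_block_mat[of _ m m _ r _ r _ _ m _ r]) auto
  then have "det (four_block_mat (1\<^sub>m m - K) F E (0\<^sub>m r r))
      = det (four_block_mat (1\<^sub>m m - K) (0\<^sub>m m r) E M1) *
        det (four_block_mat (1\<^sub>m m) (F + Z * F) (0\<^sub>m r m) (E * (Z * F)))"
    using M1 K E XF EZF minus_carrier_mat[OF K, of "1\<^sub>m m"]
    by (simp add: det_mult[of _ "m + r"])
  also have "\<dots> = det (1\<^sub>m m - K) * det M1 * det (E * (Z * F))"
    using M1 K E XF EZF minus_carrier_mat[OF K, of "1\<^sub>m m"]
    by (simp add: det_four_block_mat_upper_right_zero[of _ m _ r] det_four_block_mat_lower_left_zero[of _ m _ r])
  finally show ?thesis
    using det1 M1 assoc_mult_mat[OF E Z F] unfolding K_def[symmetric] Z_def[symmetric]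
    by simp
qed

section \<open>Edge-disjoint paths from permutations\<close>

text \<open>Indices from \<open>m\<close> on are the border. Each border index is followed under
  \<open>p\<close> until the orbit first re-enters the border; the indices visited in between form
  the segment. Segments of different starting points cannot meet, since \<open>p\<close> is
  injective. The clause \<open>i \<noteq> j\<close> will ensure that a step uses an off-diagonal
  matrix entry, to which the identity contributes nothing.\<close>

lemma permutes_segments:
  fixes p :: "nat \<Rightarrow> nat"
  assumes p: "p permutes {0..<m + r}" and start: "\<And>c. c < r \<Longrightarrow> p (m + c) < m"
  shows "\<exists>w. (\<forall>c<r. w c \<noteq> [] \<and> hd (w c) = p (m + c) \<and> set (w c) \<subseteq> {..<m} \<and> p (last (w c)) \<in> {m..<m + r}
      \<and> successively (\<lambda>i j. j = p i \<and> i \<noteq> j) (w c))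
    \<and> (\<forall>c<r. \<forall>d<r. c \<noteq> d \<longrightarrow> set (w c) \<inter> set (w d) = {})"
proof -
  have inj: "inj p" using p permutes_inj by blast
  have injn: "inj (p ^^ n)" for n using inj by (simp add: inj_fn)
  have range: "(p ^^ n) (m + c) < m + r" if "c < r" for n c
    using that by (induct n) (use permutes_in_image[OF p] in \<open>auto simp: atLeastLessThan_iff\<close>)
  \<comment> \<open>First return time to the border. It exists because \<open>m + c\<close> lies on
    a finite cycle of \<open>p\<close>.\<close>
  define N where "N c = (LEAST n. n > 0 \<and> (p ^^ n) (m + c) \<ge> m)" for c
  have N: "N c > 0 \<and> (p ^^ N c) (m + c) \<ge> m" if c: "c < r" for c
  proof -
    have "finite {y. \<exists>n. y = (p ^^ n) (m + c)}"
      by (rule finite_subset[of _ "{..<m + r}"]) (use range[OF c] in auto)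
    then obtain n where "n > 0" "(p ^^ n) (m + c) = m + c"
      using funpow_inj_finite[OF inj] by blast
    then show ?thesis 
      unfolding N_def using LeastI[of "\<lambda>n. n > 0 \<and> (p ^^ n) (m + c) \<ge> m" n] by simp
  qed
  have less_N: "(p ^^ n) (m + c) < m" if "0 < n" "n < N c" for n c
    using that not_less_Least[of n "\<lambda>n. n > 0 \<and> (p ^^ n) (m + c) \<ge> m"] unfolding N_def by auto
  have N2: "N c \<ge> 2" if "c < r" for c
  proof (rule ccontr)
    assume "\<not> N c \<ge> 2"
    then have "N c = 1" using N[OF that] by simp
    then show False using N[OF that] start[OF that] by simp
  qed
  define w where "w c = map (\<lambda>j. (p ^^ Suc j) (m + c)) [0..<N c - 1]" for c
  have len: "length (w c) = N c - 1" for c by (simp add: w_def)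
  have nth: "w c ! j = (p ^^ Suc j) (m + c)" if "j < N c - 1" for c j
    using that by (simp add: w_def)
  have ne: "w c \<noteq> []" if "c < r" for c using N2[OF that] len[of c] by auto
  \<comment> \<open>Cancelling the common power of \<open>p\<close> at a meeting point leaves the
    start \<open>m + c\<close> on the orbit of \<open>m + d\<close>, either at time 0 or strictly
    before the first return.\<close>
  have overlap: False
    if "c < r" "d < r" "c \<noteq> d" "i \<le> j" "j < N d - 1" "(p ^^ Suc i) (m + c) = (p ^^ Suc j) (m + d)" for c d i j
  proof -
    have "Suc j = Suc i + (j - i)" using that by simp
    then have "(p ^^ Suc i) (m + c) = (p ^^ Suc i) ((p ^^ (j - i)) (m + d))"
      using that(6) by (metis comp_apply funpow_add)
    then have eq: "m + c = (p ^^ (j - i)) (m + d)" using injn by (meson injD)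
    show False
    proof (cases "j = i")
      case False
      then have "0 < j - i" "j - i < N d" using that by linarith+
      then show ?thesis using less_N[of "j - i" d] eq by simp
    qed (use eq that in auto)
  qed
  show ?thesis
  proof (intro exI[of _ w] conjI allI impI)
    fix c assume c: "c < r"
    show "w c \<noteq> []" by (rule ne[OF c])
    show "hd (w c) = p (m + c)" using N2[OF c] ne[OF c] nth[of 0 c] by (simp add: hd_conv_nth)
    show "set (w c) \<subseteq> {..<m}" unfolding w_def using less_N[of "Suc _" c] by (auto simp del: funpow.simps)
    have "last (w c) = (p ^^ (N c - 1)) (m + c)"
      using ne[OF c] N2[OF c] nth[of "N c - 2" c] by (simp add: last_conv_nth len numeral_2_eq_2 Suc_diff_Suc del: funpow.simps)
    moreover have "p ((p ^^ (N c - 1)) (m + c)) = (p ^^ N c) (m + c)"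
      using N[OF c] by (metis Suc_pred' comp_apply funpow.simps(2))
    ultimately show "p (last (w c)) \<in> {m..<m + r}" using N[OF c] range[OF c] by auto
    \<comment> \<open>A fixed point on the orbit would pull back to a fixed point
      \<open>m + c\<close>, contradicting \<open>start\<close>.\<close>
    have "(p ^^ Suc j) (m + c) \<noteq> p ((p ^^ Suc j) (m + c))" for j
    proof
      assume "(p ^^ Suc j) (m + c) = p ((p ^^ Suc j) (m + c))"
      then have "(p ^^ Suc j) (m + c) = (p ^^ Suc j) (p (m + c))" by (simp only: funpow_swap1)
      then have "m + c = p (m + c)" using injn by (meson injD)
      then show False using start[OF c] by simp
    qed
    then show "successively (\<lambda>i j. j = p i \<and> i \<noteq> j) (w c)"
      unfolding successively_conv_nth len by (auto simp: nth)
  next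
    fix c d assume "c < r" "d < r" "c \<noteq> d"
    show "set (w c) \<inter> set (w d) = {}"
    proof (rule ccontr)
      assume "set (w c) \<inter> set (w d) \<noteq> {}"
      then obtain i j where "i < N c - 1" "j < N d - 1" "(p ^^ Suc i) (m + c) = (p ^^ Suc j) (m + d)"
        unfolding w_def by (auto simp del: funpow.simps)
      then show False using overlap[of c d i j] overlap[of d c j i] \<open>c < r\<close> \<open>d < r\<close> \<open>c \<noteq> d\<close>
        by (metis nat_le_linear)
    qed
  qed
qed

lemma det_nonzero_permutes:
  fixes A :: "'a::comm_ring_1 mat"
  assumes "A \<in> carrier_mat n n" "det A \<noteq> 0"
  obtains p where "p permutes {0..<n}" "\<And>i. i < n \<Longrightarrow> A $$ (i, p i) \<noteq> 0"
proof -
  obtain p where p: "p permutes {0..<n}" "signof p * (\<Prod>i = 0..<n. A $$ (i, p i)) \<noteq> 0"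
    using assms sum.not_neutral_contains_not_neutral unfolding det_def'[OF assms(1)] by (metis (no_types, lifting) mem_Collect_eq)
  have "A $$ (i, p i) \<noteq> 0" if "i < n" for i
  proof
    assume "A $$ (i, p i) = 0"
    then have "(\<Prod>i = 0..<n. A $$ (i, p i)) = 0" using that by (intro prod_zero) auto
    then show False using p(2) by simp
  qed
  then show thesis using p that by blast
qed

section \<open>Projecting walks of the auxiliary graph to paths of \<open>G\<close>\<close>

lemma split_graph_simps [simp]:
  "tail (split_graph k G) (Old_Arc e) = Out (tail G e)"
  "tail (split_graph k G) (To_Out v j) = Orig v"
  "tail (split_graph k G) (From_In v j) = In v"
  "head (split_graph k G) (Old_Arc e) = In (head G e)"
  "head (split_graph k G) (To_Out v j) = Out v"
  "head (split_graph k G) (From_In v j) = Orig v"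
  "Old_Arc e \<in> arcs (split_graph k G) \<longleftrightarrow> e \<in> arcs G"
  "To_Out v j \<in> arcs (split_graph k G) \<longleftrightarrow> v \<in> verts G \<and> j < k"
  "From_In v j \<in> arcs (split_graph k G) \<longleftrightarrow> v \<in> verts G \<and> j < k"
  by (auto simp: split_graph_def)

lemma out_arcs_split_graph: "s \<in> verts G \<Longrightarrow> out_arcs (split_graph k G) (Orig s) = To_Out s ` {..<k}"
  by (auto simp: out_arcs_def split_graph_def)

lemma in_arcs_split_graph: "t \<in> verts G \<Longrightarrow> in_arcs (split_graph k G) (Orig t) = From_In t ` {..<k}"
  by (auto simp: in_arcs_def split_graph_def)

primrec base :: "'v split_vertex \<Rightarrow> 'v" where
  "base (Orig v) = v"
| "base (Out v) = v"
| "base (In v) = v"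

primrec old_arcs :: "('v,'e) split_arc list \<Rightarrow> 'e list" where
  "old_arcs [] = []"
| "old_arcs (a # h) = (case a of Old_Arc e \<Rightarrow> [e] | _ \<Rightarrow> []) @ old_arcs h"

lemma set_old_arcs: "e \<in> set (old_arcs h) \<longleftrightarrow> Old_Arc e \<in> set h"
  by (induct h) (auto split: split_arc.splits)

context loopfree_digraph begin

text \<open>Edges \<open>To_Out\<close> and \<open>From_In\<close> join two copies of the same
  vertex, so they disappear when the three copies are contracted by \<open>base\<close>.\<close>

lemma awalk_old_arcs:
  assumes "h \<noteq> []" "set h \<subseteq> arcs (split_graph k G)"
    and "successively (\<lambda>a b. head (split_graph k G) a = tail (split_graph k G) b) h"
  shows "awalk (base (tail (split_graph k G) (hd h))) (old_arcs h) (base (head (split_graph k G) (last h)))"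
  using assms
proof (induct h rule: list_nonempty_induct)
  case (single a)
  then show ?case by (cases a) (auto simp: awalk_simps)
next
  case (cons a h)
  then have IH: "awalk (base (head (split_graph k G) a)) (old_arcs h) (base (head (split_graph k G) (last h)))"
    by (simp add: successively_Cons)
  show ?case using cons(1,3) IH by (cases a) (auto simp: awalk_simps)
qed

text \<open>The inclusion of \<open>Old_Arc\<close> applied to the path in \<open>h\<close> is what
  transfers edge-disjointness from the walks \<open>h\<close> to the paths.\<close>

lemma st_path_of_split_walk:
  assumes h: "h \<noteq> []" "set h \<subseteq> arcs (split_graph k G)"
    and succ: "successively (\<lambda>a b. head (split_graph k G) a = tail (split_graph k G) b) h"
    and s: "tail (split_graph k G) (hd h) = Orig s" and t: "head (split_graph k G) (last h) = Orig t"
  obtains p where "st_path G s p t" "p \<noteq> []" "Old_Arc ` set p \<subseteq> set h"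
proof -
  have walk: "awalk s (old_arcs h) t" using awalk_old_arcs[OF h succ] s t by simp
  obtain a h' where h': "h = a # h'" using h by (cases h) auto
  obtain j where a: "a = To_Out s j" using s h' by (cases a) auto
  \<comment> \<open>After its first edge the walk is at \<open>Out s\<close>, which is not an
    original vertex, so it must continue, and only by an edge of \<open>G\<close>. This provides an
    old edge even when s = t.\<close>
  obtain b h'' where h'': "h' = b # h''" using t h' a by (cases h') auto
  obtain e where "b = Old_Arc e" using succ h' h'' a by (cases b) auto
  then obtain q where q: "old_arcs h = e # q" using h' h'' a by simp
  have old: "Old_Arc ` set p \<subseteq> set h" if "set p \<subseteq> set (old_arcs h)" for p
    using that set_old_arcs by fastforce
  show thesis
  proof (cases "s = t")
    case False
    have "apath s (awalk_to_apath (old_arcs h)) t" "set (awalk_to_apath (old_arcs h)) \<subseteq> set (old_arcs h)"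
      using walk apath_awalk_to_apath awalk_to_apath_subset by blast+
    moreover from this have "awalk_to_apath (old_arcs h) \<noteq> []" using False by (metis apath_Nil_iff)
    ultimately show thesis using False that[of "awalk_to_apath (old_arcs h)"] old
      by (simp add: st_path_def)
  next
    case True
    \<comment> \<open>Shortcutting the whole closed walk would leave the empty path. Only the walk
      after its first edge is shortened, and that edge is put back.\<close>
    have e: "e \<in> arcs G" "s = tail G e" "awalk (head G e) q s" using walk True q by (auto simp: awalk_Cons_iff)
    let ?q = "awalk_to_apath q"
    have "apath (head G e) ?q s" "set ?q \<subseteq> set q"
      using e apath_awalk_to_apath awalk_to_apath_subset by blast+
    then have "st_path G s (e # ?q) t" using e True
      by (auto simp: st_path_def apath_def awalk_Cons_iff)
    then show thesis using that[of "e # ?q"] old[of "e # ?q"] q \<open>set ?q \<subseteq> set q\<close> by auto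
  qed
qed

end

section \<open>Edge connectivity as an attained maximum\<close>

lemma (in wf_digraph) st_path_arcs: "st_path G s p t \<Longrightarrow> p \<noteq> [] \<and> set p \<subseteq> arcs G"
  by (auto simp: st_path_def apath_def awalk_Nil_iff split: if_splits)

context fin_digraph begin

text \<open>Pairwise disjoint nonempty paths have distinct first edges, so \<open>hd\<close> injects
  each family into the arcs.\<close>

lemma finite_disjoint_path_cards:
  "finite {card P | P. finite P \<and> (\<forall>p\<in>P. st_path G s p t) \<and> pairwise (\<lambda>p q. set p \<inter> set q = {}) P}"
proof -
  have "card P \<le> card (arcs G)"
    if P: "finite P" "\<forall>p\<in>P. st_path G s p t" "pairwise (\<lambda>p q. set p \<inter> set q = {}) P" for P
  proof (rule card_inj_on_le[of hd])
    show "inj_on hd P"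
    proof (rule inj_onI)
      fix p q assume "p \<in> P" "q \<in> P" "hd p = hd q"
      moreover from this have "hd p \<in> set p" "hd q \<in> set q" using P(2) st_path_arcs hd_in_set by metis+
      ultimately show "p = q" using P(3) unfolding pairwise_def by (metis disjoint_iff)
    qed
    show "hd ` P \<subseteq> arcs G" using P(2) st_path_arcs by (metis (no_types) hd_in_set image_subsetI subsetD)
  qed simp
  then have "{card P | P. finite P \<and> (\<forall>p\<in>P. st_path G s p t) \<and> pairwise (\<lambda>p q. set p \<inter> set q = {}) P} \<subseteq> {..card (arcs G)}"
    by blast
  then show ?thesis by (rule finite_subset) simp
qed

lemma edge_connectivity_attained:
  obtains P where "finite P" "\<forall>p\<in>P. st_path G s p t" "pairwise (\<lambda>p q. set p \<inter> set q = {}) P"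
    "card P = edge_connectivity G s t"
proof -
  have "edge_connectivity G s t \<in> {card P | P. finite P \<and> (\<forall>p\<in>P. st_path G s p t) \<and> pairwise (\<lambda>p q. set p \<inter> set q = {}) P}"
    unfolding edge_connectivity_def by (rule Max_in[OF finite_disjoint_path_cards]) (auto intro!: exI[of _ "{}"])
  then show thesis using that by auto
qed

lemma edge_connectivity_ge:
  assumes path: "\<And>c. c < r \<Longrightarrow> st_path G s (p c) t"
    and disj: "\<And>c d. c < r \<Longrightarrow> d < r \<Longrightarrow> c \<noteq> d \<Longrightarrow> set (p c) \<inter> set (p d) = {}"
  shows "r \<le> edge_connectivity G s t"
proof -
  have "inj_on p {..<r}"
  proof (rule inj_onI)
    fix c d assume "c \<in> {..<r}" "d \<in> {..<r}" "p c = p d"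
    then show "c = d" using disj[of c d] path[of c] st_path_arcs[of s "p c" t] by auto
  qed
  then have "card (p ` {..<r}) = r" by (simp add: card_image)
  moreover have "pairwise (\<lambda>p q. set p \<inter> set q = {}) (p ` {..<r})"
    using disj unfolding pairwise_def by auto
  ultimately show ?thesis
    unfolding edge_connectivity_def using path
    by (intro Max_ge[OF finite_disjoint_path_cards] CollectI exI[of _ "p ` {..<r}"] conjI) auto
qed

end

text \<open>Collects what the witness for the lower bound uses: distinct tails make the successor of
  an edge unique, also on a cycle, and \<open>t\<close> is never left again after the first
  edge.\<close>

lemma st_path_distinct:
  assumes "wf_digraph G" "st_path G s p t"
  shows "distinct (map (tail G) p)" "tail G (hd p) = s" "head G (last p) = t" "t \<notin> tail G ` set (tl p)"
    "successively (\<lambda>a b. head G a = tail G b) p"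
proof -
  interpret wf_digraph G by fact
  have walk: "awalk s p t" and ne: "p \<noteq> []"
    using assms by (auto simp: st_path_def apath_def awalk_Nil_iff split: if_splits)
  show s: "tail G (hd p) = s" using walk ne by (cases p) (auto simp: awalk_Cons_iff)
  show t: "head G (last p) = t" using awlast_of_awalk[OF walk] ne by (simp add: awalk_verts_conv)
  have verts: "awalk_verts s p = s # map (tail G) (tl p) @ [t]"
    using s t ne by (cases p) (simp_all add: awalk_verts_conv)
  \<comment> \<open>For s = t the definition of \<open>st_path\<close> grants distinctness only
    after the first vertex, which is exactly this list.\<close>
  have "distinct (map (tail G) (tl p) @ [t])"
    using assms(2) verts unfolding st_path_def apath_def by (metis distinct.simps(2) list.sel(3))
  moreover have "s = t \<or> s \<notin> set (map (tail G) (tl p))"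
    using assms(2) verts unfolding st_path_def apath_def by auto
  ultimately show "distinct (map (tail G) p)" "t \<notin> tail G ` set (tl p)"
    using s ne by (cases p; auto)+
  show "successively (\<lambda>a b. head G a = tail G b) p"
    using walk by (induct p arbitrary: s) (auto simp: awalk_Cons_iff successively_Cons neq_Nil_conv)
qed

section \<open>Zeros of polynomial functions over finite fields\<close>

text \<open>
  A polynomial function of several variables of total degree at
  most \<open>d\<close> is represented by the property that its restriction to every line is a univariate
  polynomial of degree at most \<open>d\<close>, which is all the counting argument needs.
\<close>

definition line_degree_le :: "nat \<Rightarrow> (('i \<Rightarrow> 'a) \<Rightarrow> 'a::comm_ring_1) \<Rightarrow> bool" where
  "line_degree_le d f \<longleftrightarrow> (\<forall>a y. \<exists>q. degree q \<le> d \<and> (\<forall>t. f (\<lambda>i. a i + t * y i) = poly q t))"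

lemma line_degree_leE:
  assumes "line_degree_le d f"
  obtains q where "degree q \<le> d" "\<And>t. f (\<lambda>i. a i + t * y i) = poly q t"
  using assms unfolding line_degree_le_def by blast

lemma line_degree_le_const: "line_degree_le d (\<lambda>x. c)"
  unfolding line_degree_le_def by (auto intro: exI[of _ "[:c:]"])

lemma line_degree_le_coord: "line_degree_le 1 (\<lambda>x. x i)"
  unfolding line_degree_le_def
  by (intro allI exI[of _ "[:_, _:]"]) (auto simp: algebra_simps)

lemma line_degree_le_diff:
  assumes "line_degree_le d f" "line_degree_le d g"
  shows "line_degree_le d (\<lambda>x. f x - g x)"
  unfolding line_degree_le_def
proof (intro allI)
  fix a y
  obtain p where p: "degree p \<le> d" "\<And>t. f (\<lambda>i. a i + t * y i) = poly p t"
    using line_degree_leE[OF assms(1)] by blast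
  obtain q where q: "degree q \<le> d" "\<And>t. g (\<lambda>i. a i + t * y i) = poly q t"
    using line_degree_leE[OF assms(2)] by blast
  show "\<exists>q. degree q \<le> d \<and> (\<forall>t. f (\<lambda>i. a i + t * y i) - g (\<lambda>i. a i + t * y i) = poly q t)"
    by (rule exI[of _ "p - q"]) (use p q in \<open>auto intro: degree_diff_le\<close>)
qed

lemma line_degree_le_mult:
  assumes "line_degree_le d f" "line_degree_le e g"
  shows "line_degree_le (d + e) (\<lambda>x. f x * g x)"
  unfolding line_degree_le_def
proof (intro allI)
  fix a y
  obtain p where p: "degree p \<le> d" "\<And>t. f (\<lambda>i. a i + t * y i) = poly p t"
    using line_degree_leE[OF assms(1)] by blast
  obtain q where q: "degree q \<le> e" "\<And>t. g (\<lambda>i. a i + t * y i) = poly q t"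
    using line_degree_leE[OF assms(2)] by blast
  have "degree (p * q) \<le> d + e" using degree_mult_le[of p q] p q by linarith
  then show "\<exists>q. degree q \<le> d + e \<and> (\<forall>t. f (\<lambda>i. a i + t * y i) * g (\<lambda>i. a i + t * y i) = poly q t)"
    using p q by (intro exI[of _ "p * q"]) auto
qed

lemma line_degree_le_sum:
  assumes "\<And>j. j \<in> J \<Longrightarrow> line_degree_le d (f j)"
  shows "line_degree_le d (\<lambda>x. \<Sum>j\<in>J. f j x)"
  unfolding line_degree_le_def
proof (intro allI)
  fix a y
  have "\<forall>j\<in>J. \<exists>p. degree p \<le> d \<and> (\<forall>t. f j (\<lambda>i. a i + t * y i) = poly p t)"
    using assms unfolding line_degree_le_def by blast
  then obtain p where p: "\<forall>j\<in>J. degree (p j) \<le> d \<and> (\<forall>t. f j (\<lambda>i. a i + t * y i) = poly (p j) t)"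
    by metis
  have "degree (sum p J) \<le> d"
    by (cases "finite J") (use p in \<open>auto intro: degree_sum_le\<close>)
  then show "\<exists>q. degree q \<le> d \<and> (\<forall>t. (\<Sum>j\<in>J. f j (\<lambda>i. a i + t * y i)) = poly q t)"
    using p by (intro exI[of _ "sum p J"]) (auto simp: poly_sum)
qed

lemma line_degree_le_prod:
  assumes "finite J" "\<And>j. j \<in> J \<Longrightarrow> line_degree_le d (f j)"
  shows "line_degree_le (card J * d) (\<lambda>x. \<Prod>j\<in>J. f j x)"
  using assms
proof (induct J rule: finite_induct)
  case empty
  then show ?case by (simp add: line_degree_le_const)
next
  case (insert j J)
  then show ?case using line_degree_le_mult[of d "f j" "card J * d"] by simp
qed

lemma line_degree_le_det:
  assumes A: "\<And>x. A x \<in> carrier_mat n n"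
    and entries: "\<And>i j. i < n \<Longrightarrow> j < n \<Longrightarrow> line_degree_le d (\<lambda>x. A x $$ (i, j))"
  shows "line_degree_le (n * d) (\<lambda>x. det (A x))"
  unfolding det_def'[OF A]
proof (rule line_degree_le_sum)
  fix p assume "p \<in> {p. p permutes {0..<n}}"
  then have "p i < n" if "i < n" for i
    using that permutes_in_image[of p "{0..<n}" i] by auto
  then have "line_degree_le (n * d) (\<lambda>x. \<Prod>i = 0..<n. A x $$ (i, p i))"
    using line_degree_le_prod[of "{0..<n}" d "\<lambda>i x. A x $$ (i, p i)"] entries by simp
  then show "line_degree_le (n * d) (\<lambda>x. signof p * (\<Prod>i = 0..<n. A x $$ (i, p i)))"
    using line_degree_le_mult[OF line_degree_le_const[of 0]] by fastforce
qed

text \<open>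
  Instead of inducting on the number of variables, average over the lines through a nonzero
  \<open>a\<close> of \<open>f\<close>: for each scalar \<open>t \<noteq> 0\<close> the point \<open>a + t y\<close> is uniform if \<open>y\<close> is, and for
  each direction \<open>y\<close> at most \<open>d\<close> scalars \<open>t\<close> give a zero.
\<close>

lemma prob_zero_le:
  fixes f :: "('i \<Rightarrow> 'a::{field,finite}) \<Rightarrow> 'a"
  assumes I: "finite I" and f: "line_degree_le d f" and a: "f a \<noteq> 0" "\<And>i. i \<notin> I \<Longrightarrow> a i = 0"
  shows "measure_pmf.prob (Pi_pmf I 0 (\<lambda>_. pmf_of_set UNIV)) {x. f x = 0} \<le> real d / (real CARD('a) - 1)"
proof -
  define S where "S = PiE_dflt I (0::'a) (\<lambda>_. UNIV)"
  have S_iff: "y \<in> S \<longleftrightarrow> (\<forall>i. i \<notin> I \<longrightarrow> y i = 0)" for y unfolding S_def PiE_dflt_def by auto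
  have finS: "finite S" unfolding S_def using I by (intro finite_PiE_dflt) auto
  have neS: "S \<noteq> {}" using a(2) S_iff by blast
  define Z where "Z = {x \<in> S. f x = 0}"
  have "1 < CARD('a)"
    using card_mono[of "UNIV :: 'a set" "{0, 1}"] by simp
  \<comment> \<open>The affine map preserves \<open>S\<close> because \<open>a\<close> vanishes
    outside \<open>I\<close>, as every sample does.\<close>
  have "card {y \<in> S. f (\<lambda>i. a i + t * y i) = 0} = card Z" if "t \<noteq> 0" for t
  proof (rule bij_betw_same_card[of "\<lambda>y i. a i + t * y i"], rule bij_betw_byWitness[of _ "\<lambda>x i. (x i - a i) / t"])
    show "(\<lambda>x i. (x i - a i) / t) ` Z \<subseteq> {y \<in> S. f (\<lambda>i. a i + t * y i) = 0}"
      using that a(2) by (auto simp: Z_def S_iff)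
  qed (use that a(2) in \<open>auto simp: Z_def S_iff\<close>)
  then have "(\<Sum>t\<in>UNIV - {0::'a}. card {y \<in> S. f (\<lambda>i. a i + t * y i) = 0}) = (CARD('a) - 1) * card Z"
    by (simp add: card_Diff_subset)
  moreover have "(\<Sum>t\<in>UNIV - {0::'a}. card {y \<in> S. f (\<lambda>i. a i + t * y i) = 0})
      = (\<Sum>y\<in>S. card {t \<in> UNIV - {0}. f (\<lambda>i. a i + t * y i) = 0})"
    using sum.swap_restrict[of "UNIV - {0::'a}" S "\<lambda>_ _. 1::nat" "\<lambda>t y. f (\<lambda>i. a i + t * y i) = 0"] finS
    by simp
  moreover have "\<dots> \<le> (\<Sum>y\<in>S. d)"
  proof (rule sum_mono)
    fix y
    obtain q where q: "degree q \<le> d" "\<And>t. f (\<lambda>i. a i + t * y i) = poly q t"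
      using line_degree_leE[OF f] by blast
    have "q \<noteq> 0" using q(2)[of 0] a(1) by auto
    have "card {t \<in> UNIV - {0}. f (\<lambda>i. a i + t * y i) = 0} \<le> card {t. poly q t = 0}"
      using q by (intro card_mono) auto
    then show "card {t \<in> UNIV - {0}. f (\<lambda>i. a i + t * y i) = 0} \<le> d"
      using card_poly_roots_bound[OF \<open>q \<noteq> 0\<close>] q(1) by linarith
  qed
  ultimately have "(CARD('a) - 1) * card Z \<le> card S * d" by simp
  then have "real ((CARD('a) - 1) * card Z) \<le> real (card S * d)" by (rule of_nat_mono)
  then have "(real CARD('a) - 1) * real (card Z) \<le> real (card S) * real d"
    using \<open>1 < CARD('a)\<close> by (simp add: of_nat_diff)
  then have "real (card Z) / real (card S) \<le> real d / (real CARD('a) - 1)"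
    using \<open>1 < CARD('a)\<close> finS neS by (simp add: field_simps card_gt_0_iff)
  moreover have "Pi_pmf I 0 (\<lambda>_. pmf_of_set (UNIV :: 'a set)) = pmf_of_set S"
    unfolding S_def using I by (intro Pi_pmf_of_set) auto
  moreover have "S \<inter> {x. f x = 0} = Z" unfolding Z_def by auto
  ultimately show ?thesis using measure_pmf_of_set[OF neS finS] by simp
qed

section \<open>Entries of the random matrices\<close>

lemma length_concat_map_upt:
  assumes "\<And>i. i < k \<Longrightarrow> length (f i) = n"
  shows "length (concat (map f [0..<k])) = k * n"
  using assms by (induct k) auto

lemma nth_concat_map_upt:
  assumes "\<And>i. i < k \<Longrightarrow> length (f i) = n" "q < k * n"
  shows "concat (map f [0..<k]) ! q = f (q div n) ! (q mod n)"
  using assms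
proof (induct k)
  case (Suc k)
  have len: "length (concat (map f [0..<k])) = k * n"
    by (rule length_concat_map_upt) (use Suc.prems(1) in auto)
  show ?case
  proof (cases "q < k * n")
    case True
    then show ?thesis using Suc len by (simp add: nth_append)
  next
    case False
    then have "q div n = k" using Suc.prems(2) by (intro div_nat_eqI) (auto simp: algebra_simps)
    moreover have "q mod n = q - q div n * n" by (simp add: minus_div_mult_eq_mod)
    ultimately have "q div n = k" "q mod n = q - k * n" by simp_all
    then show ?thesis using False len by (simp add: nth_append)
  qed
qed simp

lemma L_mat_carrier [simp]: "L_mat H k vs es x \<in> carrier_mat (length es) (k * length vs)"
  unfolding L_mat_def using length_concat_map_upt[of k "\<lambda>i. cols (L_block H vs es x i)" "length vs"]
  by (simp add: L_block_def mat_of_cols_def)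

lemma R_mat_carrier [simp]: "R_mat H k vs es x \<in> carrier_mat (k * length vs) (length es)"
  unfolding R_mat_def using length_concat_map_upt[of k "\<lambda>i. rows (R_block H vs es x i)" "length vs"]
  by (simp add: R_block_def mat_of_rows_def)

lemma L_mat_index:
  assumes "a < length es" "q < k * length vs"
  shows "L_mat H k vs es x $$ (a, q)
    = (if head H (es ! a) = vs ! (q mod length vs) then x (Inl (q div length vs, es ! a)) else 0)"
proof -
  have n: "length vs > 0" using assms(2) by (cases vs) auto
  then have q: "q mod length vs < length vs" by simp
  have len: "length (concat (map (\<lambda>i. cols (L_block H vs es x i)) [0..<k])) = k * length vs"
    by (rule length_concat_map_upt) (simp add: L_block_def)
  have "concat (map (\<lambda>i. cols (L_block H vs es x i)) [0..<k]) ! q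
      = cols (L_block H vs es x (q div length vs)) ! (q mod length vs)"
    by (rule nth_concat_map_upt) (use assms in \<open>auto simp: L_block_def\<close>)
  then show ?thesis
    unfolding L_mat_def using assms q len by (simp add: mat_of_cols_index L_block_def)
qed

lemma R_mat_index:
  assumes "b < length es" "q < k * length vs"
  shows "R_mat H k vs es x $$ (q, b)
    = (if tail H (es ! b) = vs ! (q mod length vs) then x (Inr (q div length vs, es ! b)) else 0)"
proof -
  have n: "length vs > 0" using assms(2) by (cases vs) auto
  then have q: "q mod length vs < length vs" by simp
  have len: "length (concat (map (\<lambda>i. rows (R_block H vs es x i)) [0..<k])) = k * length vs"
    by (rule length_concat_map_upt) (simp add: R_block_def)
  have "concat (map (\<lambda>i. rows (R_block H vs es x i)) [0..<k]) ! q
      = rows (R_block H vs es x (q div length vs)) ! (q mod length vs)"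
    by (rule nth_concat_map_upt) (use assms in \<open>auto simp: R_block_def\<close>)
  then show ?thesis
    unfolding R_mat_def using assms q len by (simp add: mat_of_rows_index R_block_def)
qed

text \<open>In each layer, row \<open>a\<close> of \<open>L\<close> is supported at the single
  column of the head of its edge. Hence \<open>L R\<close> is the adjacency matrix of consecutive
  edges, weighted by an inner product over the layers.\<close>

lemma LR_index:
  assumes vs: "distinct vs" "head H (es ! a) \<in> set vs" and a: "a < length es" and b: "b < length es"
  shows "(L_mat H k vs es x * R_mat H k vs es x) $$ (a, b)
    = (if head H (es ! a) = tail H (es ! b) then \<Sum>i<k. x (Inl (i, es ! a)) * x (Inr (i, es ! b)) else 0)"
proof -
  let ?n = "length vs"
  obtain h where h: "h < ?n" "vs ! h = head H (es ! a)" using vs(2) by (auto simp: in_set_conv_nth)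
  have h_eq: "head H (es ! a) = vs ! j \<longleftrightarrow> j = h" if "j < ?n" for j
    using h that vs(1) by (auto simp: nth_eq_iff_index_eq)
  define g where "g q = L_mat H k vs es x $$ (a, q) * R_mat H k vs es x $$ (q, b)" for q
  have shift: "sum g {i * ?n..<i * ?n + ?n} = (\<Sum>j<?n. g (i * ?n + j))" for i
    using sum.shift_bounds_nat_ivl[of g 0 "i * ?n" ?n] by (simp add: lessThan_atLeast0 add.commute)
  have "(L_mat H k vs es x * R_mat H k vs es x) $$ (a, b) = (\<Sum>q = 0..<k * ?n. g q)"
    unfolding g_def using a b carrier_matD[OF L_mat_carrier[of H k vs es x]] carrier_matD[OF R_mat_carrier[of H k vs es x]]
    by (simp add: scalar_prod_def)
  also have "\<dots> = (\<Sum>i<k. \<Sum>q = i * ?n..<i * ?n + ?n. g q)"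
    by (simp add: sum.nat_group lessThan_atLeast0[symmetric])
  also have "\<dots> = (\<Sum>i<k. \<Sum>j<?n. g (i * ?n + j))"
    by (simp only: shift)
  also have "\<dots> = (\<Sum>i<k. \<Sum>j<?n. if j = h then (if head H (es ! a) = tail H (es ! b)
      then x (Inl (i, es ! a)) * x (Inr (i, es ! b)) else 0) else 0)"
  proof (intro sum.cong refl)
    fix i j assume "i \<in> {..<k}" and j: "j \<in> {..<?n}"
    then have "Suc i * ?n \<le> k * ?n" by (intro mult_le_mono1) auto
    then have q: "i * ?n + j < k * ?n" using j by simp
    have "vs \<noteq> []" using j by auto
    then have dm: "(i * ?n + j) div ?n = i" "(i * ?n + j) mod ?n = j" using j by simp_all
    show "g (i * ?n + j) = (if j = h then (if head H (es ! a) = tail H (es ! b)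
      then x (Inl (i, es ! a)) * x (Inr (i, es ! b)) else 0) else 0)"
      unfolding g_def L_mat_index[OF a q] R_mat_index[OF b q] dm using j h h_eq[of j] by auto
  qed
  also have "\<dots> = (if head H (es ! a) = tail H (es ! b) then \<Sum>i<k. x (Inl (i, es ! a)) * x (Inr (i, es ! b)) else 0)"
    using h by simp
  finally show ?thesis .
qed

section \<open>Blocks of \<open>M\<close> as reindexed entries of \<open>L Y R\<close>\<close>

lemma rows_submatrix: "rows (submatrix A I UNIV) = nths (rows A) I"
proof (rule nth_equalityI)
  show "length (rows (submatrix A I UNIV)) = length (nths (rows A) I)"
    by (simp add: length_nths dim_submatrix)
  fix i assume "i < length (rows (submatrix A I UNIV))"
  then have i: "i < card {i. i < dim_row A \<and> i \<in> I}" by (simp add: dim_submatrix)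
  have "row (submatrix A I UNIV) i = row A (pick I i)"
    by (rule eq_vecI) (use i pick_le[OF i] in \<open>auto simp: dim_submatrix submatrix_index pick_UNIV\<close>)
  then show "rows (submatrix A I UNIV) ! i = nths (rows A) I ! i"
    using i pick_le[OF i] by (simp add: nth_nths dim_submatrix)
qed

lemma cols_submatrix: "cols (submatrix A UNIV J) = nths (cols A) J"
proof (rule nth_equalityI)
  show "length (cols (submatrix A UNIV J)) = length (nths (cols A) J)"
    by (simp add: length_nths dim_submatrix)
  fix j assume "j < length (cols (submatrix A UNIV J))"
  then have j: "j < card {j. j < dim_col A \<and> j \<in> J}" by (simp add: dim_submatrix)
  have "col (submatrix A UNIV J) j = col A (pick J j)"
    by (rule eq_vecI) (use j pick_le[OF j] in \<open>auto simp: dim_submatrix submatrix_index pick_UNIV\<close>)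
  then show "cols (submatrix A UNIV J) ! j = nths (cols A) J ! j"
    using j pick_le[OF j] by (simp add: nth_nths dim_submatrix)
qed

text \<open>Positions in \<open>es\<close> are recorded instead of edges: the rows of
  \<open>L_tilde\<close> and the labels \<open>out_order\<close> then become images of one list and
  are aligned by construction; likewise for the columns.\<close>

definition indices :: "'e list \<Rightarrow> 'e set list \<Rightarrow> nat list" where
  "indices es Ss = concat (map (\<lambda>S. nths [0..<length es] (positions es S)) Ss)"

lemma concat_nths_positions:
  "concat (map (\<lambda>S. nths (map f [0..<length es]) (positions es S)) Ss) = map f (indices es Ss)"
  unfolding indices_def by (simp add: List.nths_map map_concat comp_def)

lemma indices_less: "a \<in> set (indices es Ss) \<Longrightarrow> a < length es"
  unfolding indices_def by (auto dest: in_set_nthsD)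

lemma concat_filter_eq_indices:
  "concat (map (\<lambda>S. filter (\<lambda>e. e \<in> S) es) Ss) = map ((!) es) (indices es Ss)"
proof -
  have "filter (\<lambda>e. e \<in> S) es = nths (map ((!) es) [0..<length es]) (positions es S)" for S
    by (simp add: filter_eq_nths positions_def map_nth)
  then show ?thesis by (simp only: concat_nths_positions)
qed

lemma out_order_eq: "out_order H es us = map ((!) es) (indices es (map (out_arcs H) us))"
  unfolding out_order_def concat_filter_eq_indices[symmetric] by (simp add: comp_def)

lemma in_order_eq: "in_order H es us = map ((!) es) (indices es (map (in_arcs H) us))"
  unfolding in_order_def concat_filter_eq_indices[symmetric] by (simp add: comp_def)

lemma L_tilde_eq:
  "L_tilde H k vs es us x
    = mat_of_rows (k * length vs) (map (row (L_mat H k vs es x)) (indices es (map (out_arcs H) us)))"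
proof -
  have "rows (L_mat H k vs es x) = map (row (L_mat H k vs es x)) [0..<length es]"
    unfolding rows_def using carrier_matD[OF L_mat_carrier] by metis
  then show ?thesis
    unfolding L_tilde_def rows_submatrix concat_nths_positions[symmetric] by (simp add: comp_def)
qed

lemma R_tilde_eq:
  "R_tilde H k vs es us x
    = mat_of_cols (k * length vs) (map (col (R_mat H k vs es x)) (indices es (map (in_arcs H) us)))"
proof -
  have "cols (R_mat H k vs es x) = map (col (R_mat H k vs es x)) [0..<length es]"
    unfolding cols_def using carrier_matD[OF R_mat_carrier] by metis
  then show ?thesis
    unfolding R_tilde_def cols_submatrix concat_nths_positions[symmetric] by (simp add: comp_def)
qed

lemma mat_of_rows_mult_mat_of_cols:
  fixes L Y R :: "'a::comm_semiring_1 mat"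
  assumes L: "L \<in> carrier_mat m n" and Y: "Y \<in> carrier_mat n n" and R: "R \<in> carrier_mat n m"
    and is_: "set is \<subseteq> {..<m}" and js: "set js \<subseteq> {..<m}"
  shows "mat_of_rows n (map (row L) is) * Y * mat_of_cols n (map (col R) js)
    = mat (length is) (length js) (\<lambda>(i, j). (L * Y * R) $$ (is ! i, js ! j))"
proof (rule eq_matI)
  fix i j assume ij: "i < dim_row (mat (length is) (length js) (\<lambda>(i, j). (L * Y * R) $$ (is ! i, js ! j)))"
    "j < dim_col (mat (length is) (length js) (\<lambda>(i, j). (L * Y * R) $$ (is ! i, js ! j)))"
  then have i: "is ! i < m" "i < length is" and j: "js ! j < m" "j < length js" using is_ js nth_mem by fastforce+
  have row_i: "row (mat_of_rows n (map (row L) is)) i = row L (is ! i)"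
    using i L by (simp add: mat_of_rows_row)
  have "row (mat_of_rows n (map (row L) is) * Y) i = row (L * Y) (is ! i)"
    using i L Y row_i by (intro eq_vecI) auto
  moreover have "col (mat_of_cols n (map (col R) js)) j = col R (js ! j)" using j R by simp
  ultimately show "(mat_of_rows n (map (row L) is) * Y * mat_of_cols n (map (col R) js)) $$ (i, j)
    = mat (length is) (length js) (\<lambda>(i, j). (L * Y * R) $$ (is ! i, js ! j)) $$ (i, j)"
    using i j L R by simp
qed auto

lemma M_mat_eq:
  assumes inv: "mat_inverse (I_minus_RL H k vs es x) = Some Y" and Y: "Y \<in> carrier_mat (k * length vs) (k * length vs)"
  shows "M_mat H k vs es us x = mat (length (out_order H es us)) (length (in_order H es us))
    (\<lambda>(i, j). (L_mat H k vs es x * Y * R_mat H k vs es x)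
      $$ (indices es (map (out_arcs H) us) ! i, indices es (map (in_arcs H) us) ! j))"
  unfolding M_mat_def inv L_tilde_eq R_tilde_eq out_order_eq in_order_eq option.sel length_map
  by (rule mat_of_rows_mult_mat_of_cols[OF L_mat_carrier Y R_mat_carrier]) (auto dest: indices_less)

text \<open>The upper bound uses that the selected edges lie in \<open>S\<close> and
  \<open>T\<close>, the lower bound that every listed edge of \<open>S\<close> and \<open>T\<close>
  is selected.\<close>

lemma M_block_index:
  assumes inv: "mat_inverse (I_minus_RL H k vs es x) = Some Y" and Y: "Y \<in> carrier_mat (k * length vs) (k * length vs)"
  shows "\<exists>nr nc \<rho> \<sigma>.
    M_block H k vs es us x S T = mat nr nc (\<lambda>(i, j). (L_mat H k vs es x * Y * R_mat H k vs es x) $$ (\<rho> i, \<sigma> j)) \<and>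
    (\<forall>i<nr. \<rho> i < length es \<and> es ! \<rho> i \<in> S) \<and> (\<forall>j<nc. \<sigma> j < length es \<and> es ! \<sigma> j \<in> T) \<and>
    (\<forall>e \<in> S \<inter> set (out_order H es us). \<exists>i<nr. es ! \<rho> i = e) \<and>
    (\<forall>e \<in> T \<inter> set (in_order H es us). \<exists>j<nc. es ! \<sigma> j = e)"
proof -
  let ?I = "indices es (map (out_arcs H) us)" and ?J = "indices es (map (in_arcs H) us)"
  let ?Z = "L_mat H k vs es x * Y * R_mat H k vs es x"
  define A where "A = positions (out_order H es us) S"
  define B where "B = positions (in_order H es us) T"
  have A: "{i. i < length (out_order H es us) \<and> i \<in> A} = A" and B: "{i. i < length (in_order H es us) \<and> i \<in> B} = B"
    unfolding A_def B_def positions_def by auto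
  have fin: "finite A" "finite B" unfolding A_def B_def positions_def by auto
  have pickA: "pick A i \<in> A" if "i < card A" for i using pick_in_set[of i A] that by simp
  have pickB: "pick B i \<in> B" if "i < card B" for i using pick_in_set[of i B] that by simp
  define \<rho> where "\<rho> i = ?I ! pick A i" for i
  define \<sigma> where "\<sigma> j = ?J ! pick B j" for j
  have "M_block H k vs es us x S T = mat (card A) (card B) (\<lambda>(i, j). ?Z $$ (\<rho> i, \<sigma> j))"
    unfolding M_block_def M_mat_eq[OF inv Y] submatrix_def A_def[symmetric] B_def[symmetric]
  proof (rule eq_matI; simp only: dim_row_mat dim_col_mat A B)
    fix i j assume ij: "i < card A" "j < card B"
    have "pick A i < length (out_order H es us)" "pick B j < length (in_order H es us)"
      using pickA[OF ij(1)] pickB[OF ij(2)] unfolding A_def B_def positions_def by auto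
    then show "mat (card A) (card B) (\<lambda>(i, j). mat (length (out_order H es us)) (length (in_order H es us))
        (\<lambda>(i, j). ?Z $$ (?I ! i, ?J ! j)) $$ (pick A i, pick B j)) $$ (i, j)
      = mat (card A) (card B) (\<lambda>(i, j). ?Z $$ (\<rho> i, \<sigma> j)) $$ (i, j)"
      using ij by (simp add: \<rho>_def \<sigma>_def del: index_mult_mat)
  qed
  moreover have "\<rho> i < length es \<and> es ! \<rho> i \<in> S" if "i < card A" for i
    using pickA[OF that] indices_less[of "\<rho> i" es "map (out_arcs H) us"]
    unfolding A_def positions_def \<rho>_def out_order_eq by auto
  moreover have "\<sigma> j < length es \<and> es ! \<sigma> j \<in> T" if "j < card B" for j
    using pickB[OF that] indices_less[of "\<sigma> j" es "map (in_arcs H) us"]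
    unfolding B_def positions_def \<sigma>_def in_order_eq by auto
  moreover have "\<exists>i<card A. es ! \<rho> i = e" if "e \<in> S" "e \<in> set (out_order H es us)" for e
  proof -
    obtain q where q: "q < length (out_order H es us)" "out_order H es us ! q = e"
      using \<open>e \<in> set (out_order H es us)\<close> by (metis in_set_conv_nth)
    then have "q \<in> A" using that by (simp add: A_def positions_def)
    \<comment> \<open>The number of smaller elements is the index at which \<open>pick\<close>
      returns \<open>q\<close>.\<close>
    then have "card {a \<in> A. a < q} < card A" using fin by (intro psubset_card_mono) auto
    moreover have "pick A (card {a \<in> A. a < q}) = q" using \<open>q \<in> A\<close> by (rule pick_card_in_set)
    ultimately show ?thesis using q unfolding \<rho>_def out_order_eq by auto
  qed
  moreover have "\<exists>j<card B. es ! \<sigma> j = e" if "e \<in> T" "e \<in> set (in_order H es us)" for e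
  proof -
    obtain q where q: "q < length (in_order H es us)" "in_order H es us ! q = e"
      using \<open>e \<in> set (in_order H es us)\<close> by (metis in_set_conv_nth)
    then have "q \<in> B" using that by (simp add: B_def positions_def)
    then have "card {a \<in> B. a < q} < card B" using fin by (intro psubset_card_mono) auto
    moreover have "pick B (card {a \<in> B. a < q}) = q" using \<open>q \<in> B\<close> by (rule pick_card_in_set)
    ultimately show ?thesis using q unfolding \<sigma>_def in_order_eq by auto
  qed
  ultimately show ?thesis
    by (intro exI[of _ "card A"] exI[of _ "card B"] exI[of _ \<rho>] exI[of _ \<sigma>]) blast
qed

text \<open>Selection is written as multiplication so that a compression of a block becomes a
  compression of the full matrix by associativity.\<close>

definition row_selection :: "nat \<Rightarrow> nat \<Rightarrow> (nat \<Rightarrow> nat) \<Rightarrow> 'a::zero_neq_one mat" where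
  "row_selection r m \<rho> = mat r m (\<lambda>(i, a). if a = \<rho> i then 1 else 0)"

definition col_selection :: "nat \<Rightarrow> nat \<Rightarrow> (nat \<Rightarrow> nat) \<Rightarrow> 'a::zero_neq_one mat" where
  "col_selection m r \<sigma> = mat m r (\<lambda>(a, j). if a = \<sigma> j then 1 else 0)"

lemma selection_carrier [simp]:
  "row_selection r m \<rho> \<in> carrier_mat r m" "col_selection m r \<sigma> \<in> carrier_mat m r"
  unfolding row_selection_def col_selection_def by auto

lemma selection_mult:
  fixes Z :: "'a::field mat"
  assumes Z: "Z \<in> carrier_mat m m'" and \<rho>: "\<And>i. i < r \<Longrightarrow> \<rho> i < m" and \<sigma>: "\<And>j. j < r' \<Longrightarrow> \<sigma> j < m'"
  shows "row_selection r m \<rho> * Z * col_selection m' r' \<sigma> = mat r r' (\<lambda>(i, j). Z $$ (\<rho> i, \<sigma> j))"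
proof (rule eq_matI)
  fix i j assume "i < dim_row (mat r r' (\<lambda>(i, j). Z $$ (\<rho> i, \<sigma> j)))" "j < dim_col (mat r r' (\<lambda>(i, j). Z $$ (\<rho> i, \<sigma> j)))"
  then have i: "i < r" and j: "j < r'" by auto
  have row: "row (row_selection r m \<rho> * Z) i = row Z (\<rho> i)"
  proof (rule eq_vecI)
    fix b assume "b < dim_vec (row Z (\<rho> i))"
    then have b: "b < m'" using Z by simp
    then have "row (row_selection r m \<rho> * Z) i $ b = (\<Sum>a = 0..<m. if a = \<rho> i then Z $$ (a, b) else 0)"
      using i Z by (simp add: row_selection_def scalar_prod_def if_distrib[of "\<lambda>x. x * _"] cong: if_cong)
    then show "row (row_selection r m \<rho> * Z) i $ b = row Z (\<rho> i) $ b" using \<rho>[OF i] b Z by simp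
  qed (use Z in \<open>simp add: row_selection_def\<close>)
  have "(row_selection r m \<rho> * Z * col_selection m' r' \<sigma>) $$ (i, j) = row Z (\<rho> i) \<bullet> col (col_selection m' r' \<sigma>) j"
    using i j row by (simp add: row_selection_def col_selection_def)
  also have "\<dots> = (\<Sum>b = 0..<m'. if b = \<sigma> j then Z $$ (\<rho> i, b) else 0)"
    using i j Z \<rho>[OF i] by (simp add: col_selection_def scalar_prod_def if_distrib[of "\<lambda>x. _ * x"] cong: if_cong)
  finally show "(row_selection r m \<rho> * Z * col_selection m' r' \<sigma>) $$ (i, j) = mat r r' (\<lambda>(i, j). Z $$ (\<rho> i, \<sigma> j)) $$ (i, j)"
    using i j \<sigma>[OF j] by simp
qed (auto simp: row_selection_def col_selection_def)

section \<open>The two rank bounds\<close>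

text \<open>The border is fixed to the first \<open>r\<close> parallel edges at \<open>s\<close> and
  at \<open>t\<close>. It does not depend on the sample, so the determinant is a polynomial function
  of \<open>x\<close>.\<close>

definition bordered_mat ::
    "('v split_vertex, ('v,'e) split_arc) pre_digraph \<Rightarrow> nat \<Rightarrow> 'v split_vertex list \<Rightarrow> ('v,'e) split_arc list
      \<Rightarrow> nat \<Rightarrow> 'v \<Rightarrow> 'v \<Rightarrow> (('v,'e) split_arc, 'a::field) sample \<Rightarrow> 'a mat" where
  "bordered_mat H k vs es r s t x = four_block_mat
     (1\<^sub>m (length es) - L_mat H k vs es x * R_mat H k vs es x)
     (mat (length es) r (\<lambda>(a, c). if es ! a = From_In t c then 1 else 0))
     (mat r (length es) (\<lambda>(c, a). if es ! a = To_Out s c then 1 else 0))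
     (0\<^sub>m r r)"

lemma I_minus_RL_carrier [simp]: "I_minus_RL H k vs es x \<in> carrier_mat (k * length vs) (k * length vs)"
  unfolding I_minus_RL_def by (intro minus_carrier_mat mult_carrier_mat[OF R_mat_carrier L_mat_carrier])

lemma I_minus_RL_inverse:
  assumes "det (I_minus_RL H k vs es x) \<noteq> 0"
  obtains Y where "mat_inverse (I_minus_RL H k vs es x) = Some Y"
    "Y \<in> carrier_mat (k * length vs) (k * length vs)" "I_minus_RL H k vs es x * Y = 1\<^sub>m (k * length vs)"
    "invertible_mat (I_minus_RL H k vs es x)"
proof -
  let ?A = "I_minus_RL H k vs es x"
  have "mat_inverse ?A \<noteq> None"
    using mat_inverse(1)[OF I_minus_RL_carrier] det_non_zero_imp_unit[OF I_minus_RL_carrier assms] by metis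
  then obtain Y where Y: "mat_inverse ?A = Some Y" by auto
  note YA = mat_inverse(2)[OF I_minus_RL_carrier Y]
  then have "invertible_mat ?A"
    unfolding invertible_mat_def inverts_mat_def square_mat.simps
    using carrier_matD[OF I_minus_RL_carrier[of H k vs es x]] by (auto intro!: exI[of _ Y])
  then show thesis using that Y YA by blast
qed

locale split_matrices = fin_digraph G + loopfree_digraph G
  for G :: "('v,'e) pre_digraph" +
  fixes k :: nat and H :: "('v split_vertex, ('v,'e) split_arc) pre_digraph"
    and us :: "'v list" and vs :: "'v split_vertex list" and es :: "('v,'e) split_arc list"
  assumes H: "H = split_graph k G" and us: "set us = verts G"
    and vs: "distinct vs" "set vs = verts H" and es: "distinct es" "set es = arcs H"
begin

lemma head_in_vs: "a < length es \<Longrightarrow> head H (es ! a) \<in> set vs"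
  using fin_digraph.axioms(1)[OF split_graph_fin_digraph[OF fin_digraph_axioms, of k]] es nth_mem[of a es]
    wf_digraph.head_in_verts unfolding vs H by metis

lemmas LR_index' = LR_index[OF vs(1) head_in_vs]

lemma out_arcs_Orig: "s \<in> verts G \<Longrightarrow> out_arcs H (Orig s) = To_Out s ` {..<k}"
  and in_arcs_Orig: "t \<in> verts G \<Longrightarrow> in_arcs H (Orig t) = From_In t ` {..<k}"
  unfolding H by (auto simp: out_arcs_split_graph in_arcs_split_graph)

text \<open>The rows of \<open>E\<close> are supported in \<open>S\<close> and the columns of
  \<open>F\<close> in \<open>T\<close>. A nonzero term of the expansion thus enters through an edge
  of \<open>S\<close>, moves along nonzero off-diagonal entries of \<open>L R\<close>, that is
  between consecutive edges, and leaves through an edge of \<open>T\<close>.\<close>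

lemma mat_rank_M_block_le:
  fixes x :: "(('v,'e) split_arc, 'a::field) sample"
  assumes det: "det (I_minus_RL H k vs es x) \<noteq> 0" and s: "s \<in> verts G" and t: "t \<in> verts G"
  shows "mat_rank (M_block H k vs es us' x (out_arcs H (Orig s)) (in_arcs H (Orig t)))
    \<le> min k (edge_connectivity G s t)"
proof -
  define S where "S = out_arcs H (Orig s)"
  define T where "T = in_arcs H (Orig t)"
  let ?m = "length es"
  let ?L = "L_mat H k vs es x" and ?R = "R_mat H k vs es x"
  have ST: "S \<inter> T = {}" unfolding S_def T_def out_arcs_Orig[OF s] in_arcs_Orig[OF t] by auto
  obtain Y where inv: "mat_inverse (I_minus_RL H k vs es x) = Some Y"
    and Y: "Y \<in> carrier_mat (k * length vs) (k * length vs)" and Yinv: "I_minus_RL H k vs es x * Y = 1\<^sub>m (k * length vs)"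
    using I_minus_RL_inverse[OF det] by blast
  define Z where "Z = ?L * Y * ?R"
  have Z: "Z \<in> carrier_mat ?m ?m"
    unfolding Z_def by (intro mult_carrier_mat[OF _ R_mat_carrier] mult_carrier_mat[OF L_mat_carrier Y])
  obtain nr nc \<rho> \<sigma> where M: "M_block H k vs es us' x S T = mat nr nc (\<lambda>(i, j). Z $$ (\<rho> i, \<sigma> j))"
    and \<rho>': "\<forall>i<nr. \<rho> i < ?m \<and> es ! \<rho> i \<in> S" and \<sigma>': "\<forall>j<nc. \<sigma> j < ?m \<and> es ! \<sigma> j \<in> T"
    using M_block_index[OF inv Y, of "us'" S T, folded Z_def] by blast
  have \<rho>: "\<rho> i < ?m \<and> es ! \<rho> i \<in> S" if "i < nr" for i using \<rho>' that by blast
  have \<sigma>: "\<sigma> j < ?m \<and> es ! \<sigma> j \<in> T" if "j < nc" for j using \<sigma>' that by blast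
  define B where "B = mat nr nc (\<lambda>(i, j). Z $$ (\<rho> i, \<sigma> j))"
  define r where "r = vec_space.rank nr B"
  have B: "B \<in> carrier_mat nr nc" unfolding B_def by simp
  have rank_eq: "mat_rank (M_block H k vs es us' x S T) = r" unfolding M B_def[symmetric] r_def mat_rank_def using B by simp
  obtain P Q where P: "P \<in> carrier_mat r nr" and Q: "Q \<in> carrier_mat nc r" and PBQ: "det (P * B * Q) \<noteq> 0"
    using det_nonzero_of_rank[OF B] unfolding r_def by blast
  \<comment> \<open>The compression of the block is absorbed into the borders, which may therefore
    depend on \<open>x\<close>.\<close>
  define E where "E = P * row_selection nr ?m \<rho>"
  define F where "F = col_selection ?m nc \<sigma> * Q"
  have E: "E \<in> carrier_mat r ?m" unfolding E_def by (rule mult_carrier_mat[OF P selection_carrier(1)])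
  have F: "F \<in> carrier_mat ?m r" unfolding F_def by (rule mult_carrier_mat[OF selection_carrier(2) Q])
  have "B = row_selection nr ?m \<rho> * Z * col_selection ?m nc \<sigma>"
    unfolding B_def by (rule selection_mult[OF Z, symmetric]) (use \<rho> \<sigma> in auto)
  then have "P * B * Q = E * Z * F"
    unfolding E_def F_def using P Q Z selection_carrier[of nr ?m \<rho>] selection_carrier[of ?m nc \<sigma>]
    by (smt (verit) assoc_mult_mat mult_carrier_mat)
  then have EZF: "det (E * Z * F) \<noteq> 0" using PBQ by simp
  have E_S: "es ! a \<in> S" if "c < r" "a < ?m" "E $$ (c, a) \<noteq> 0" for c a
  proof (rule ccontr)
    assume "es ! a \<notin> S"
    then have "\<And>i. i < nr \<Longrightarrow> a \<noteq> \<rho> i" using \<rho> by auto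
    then have "E $$ (c, a) = 0" unfolding E_def row_selection_def using that(1,2) P by (simp add: scalar_prod_def)
    then show False using that by simp
  qed
  have F_T: "es ! a \<in> T" if "c < r" "a < ?m" "F $$ (a, c) \<noteq> 0" for c a
  proof (rule ccontr)
    assume "es ! a \<notin> T"
    then have "\<And>j. j < nc \<Longrightarrow> a \<noteq> \<sigma> j" using \<sigma> by auto
    then have "F $$ (a, c) = 0" unfolding F_def col_selection_def using that(1,2) Q by (simp add: scalar_prod_def)
    then show False using that by simp
  qed
  have "E * F = 0\<^sub>m r r"
  proof (rule eq_matI)
    fix c d assume "c < dim_row (0\<^sub>m r r :: 'a mat)" "d < dim_col (0\<^sub>m r r :: 'a mat)"
    then have cd: "c < r" "d < r" by auto
    then have "E $$ (c, a) * F $$ (a, d) = 0" if "a < ?m" for a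
      using E_S[OF cd(1) that] F_T[OF cd(2) that] ST by auto
    then show "(E * F) $$ (c, d) = 0\<^sub>m r r $$ (c, d)" using cd E F by (auto simp: scalar_prod_def intro!: sum.neutral)
  qed (use E F in auto)
  define N where "N = four_block_mat (1\<^sub>m ?m - ?L * ?R) F E (0\<^sub>m r r)"
  have detN: "det N \<noteq> 0"
    unfolding N_def using det_bordered_iff[OF L_mat_carrier R_mat_carrier Y _ E F \<open>E * F = 0\<^sub>m r r\<close>] EZF
      Yinv[unfolded I_minus_RL_def] unfolding Z_def by simp
  have LR: "?L * ?R \<in> carrier_mat ?m ?m" by (rule mult_carrier_mat[OF L_mat_carrier R_mat_carrier])
  have N: "N \<in> carrier_mat (?m + r) (?m + r)"
    unfolding N_def using minus_carrier_mat[OF LR, of "1\<^sub>m ?m"] by auto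
  have N_index: "N $$ (i, j) = (if i < ?m then if j < ?m then (1\<^sub>m ?m - ?L * ?R) $$ (i, j) else F $$ (i, j - ?m)
      else if j < ?m then E $$ (i - ?m, j) else 0)" if "i < ?m + r" "j < ?m + r" for i j
  proof -
    define A where "A = 1\<^sub>m ?m - ?L * ?R"
    have "A \<in> carrier_mat ?m ?m" unfolding A_def by (rule minus_carrier_mat[OF LR])
    then show ?thesis unfolding N_def A_def[symmetric] using that E F by auto
  qed
  obtain p where p: "p permutes {0..<?m + r}" and p_nz: "\<And>i. i < ?m + r \<Longrightarrow> N $$ (i, p i) \<noteq> 0"
    using det_nonzero_permutes[OF N detN] by blast
  have p_less: "p i < ?m + r" if "i < ?m + r" for i using permutes_in_image[OF p, of i] that by auto
  \<comment> \<open>The lower right block is zero, so a nonzero term cannot step from the border to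
    the border.\<close>
  have start: "p (?m + c) < ?m" if "c < r" for c
    using p_nz[of "?m + c"] N_index[of "?m + c" "p (?m + c)"] p_less[of "?m + c"] that by (auto split: if_splits)
  obtain w where w': "\<forall>c<r. w c \<noteq> [] \<and> hd (w c) = p (?m + c) \<and> set (w c) \<subseteq> {..<?m} \<and> p (last (w c)) \<in> {?m..<?m + r}
      \<and> successively (\<lambda>i j. j = p i \<and> i \<noteq> j) (w c)" "\<forall>c<r. \<forall>d<r. c \<noteq> d \<longrightarrow> set (w c) \<inter> set (w d) = {}"
    using permutes_segments[OF p start] by blast
  have w: "w c \<noteq> []" "hd (w c) = p (?m + c)" "set (w c) \<subseteq> {..<?m}" "p (last (w c)) \<in> {?m..<?m + r}"
    "successively (\<lambda>i j. j = p i \<and> i \<noteq> j) (w c)" if "c < r" for c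
    using w'(1) that by blast+
  define h where "h c = map ((!) es) (w c)" for c
  have hd_h: "hd (h c) \<in> S" if c: "c < r" for c
    using p_nz[of "?m + c"] N_index[of "?m + c" "p (?m + c)"] start[OF c] E_S[of c "p (?m + c)"] w(1,2)[OF c] c
    by (auto simp: h_def hd_map)
  have last_h: "last (h c) \<in> T" if c: "c < r" for c
  proof -
    have "last (w c) < ?m" using w(1,3)[OF c] last_in_set by blast
    then show ?thesis
      using p_nz[of "last (w c)"] N_index[of "last (w c)" "p (last (w c))"] w(1,4)[OF c]
        F_T[of "p (last (w c)) - ?m" "last (w c)"] by (auto simp: h_def last_map)
  qed
  have succ_h: "successively (\<lambda>a b. head H a = tail H b) (h c)" if c: "c < r" for c
    unfolding h_def successively_map
  proof (rule successively_mono[OF w(5)[OF c]])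
    fix i j assume "i \<in> set (w c)" "j \<in> set (w c)" and ij: "j = p i \<and> i \<noteq> j"
    then have "i < ?m" "j < ?m" using w(3)[OF c] by auto
    \<comment> \<open>Off the diagonal the entry of \<open>I - L R\<close> is minus that of
      \<open>L R\<close>.\<close>
    then have "(?L * ?R) $$ (i, j) \<noteq> 0"
      using p_nz[of i] N_index[of i j] ij carrier_matD[OF L_mat_carrier[of H k vs es x]]
        carrier_matD[OF R_mat_carrier[of H k vs es x]] by (auto simp del: index_mult_mat(1))
    then show "head H (es ! i) = tail H (es ! j)"
      unfolding LR_index'[OF \<open>i < ?m\<close> \<open>i < ?m\<close> \<open>j < ?m\<close>] by (auto split: if_splits)
  qed
  have disj_h: "set (h c) \<inter> set (h d) = {}" if "c < r" "d < r" "c \<noteq> d" for c d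
  proof -
    have "inj_on ((!) es) {..<?m}" using es(1) by (auto simp: inj_on_def nth_eq_iff_index_eq)
    then show ?thesis
      using inj_on_image_Int[of "(!) es" "{..<?m}" "set (w c)" "set (w d)"] w(3)[OF that(1)] w(3)[OF that(2)] w'(2) that
      by (simp add: h_def)
  qed
  have ne_h: "h c \<noteq> []" if "c < r" for c using w(1)[OF that] by (simp add: h_def)
  have "\<exists>q. st_path G s q t \<and> q \<noteq> [] \<and> Old_Arc ` set q \<subseteq> set (h c)" if c: "c < r" for c
  proof -
    have "set (h c) \<subseteq> arcs (split_graph k G)"
      using w(3)[OF c] es(2) nth_mem unfolding h_def H by fastforce
    moreover have "tail (split_graph k G) (hd (h c)) = Orig s" "head (split_graph k G) (last (h c)) = Orig t"
      using hd_h[OF c] last_h[OF c] unfolding S_def T_def H by auto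
    ultimately show ?thesis
      using st_path_of_split_walk[OF ne_h[OF c] _ succ_h[OF c, unfolded H]] by metis
  qed
  then obtain q where q: "\<And>c. c < r \<Longrightarrow> st_path G s (q c) t \<and> q c \<noteq> [] \<and> Old_Arc ` set (q c) \<subseteq> set (h c)"
    by metis
  have "r \<le> edge_connectivity G s t"
  proof (rule edge_connectivity_ge)
    fix c d assume "c < r" "d < r" "c \<noteq> d"
    then show "set (q c) \<inter> set (q d) = {}" using q[of c] q[of d] disj_h[of c d] by blast
  qed (use q in blast)
  moreover have "r \<le> k"
  proof -
    \<comment> \<open>Disjoint walks start with different edges, and only \<open>k\<close> edges
      leave \<open>Orig s\<close>.\<close>
    have "inj_on (\<lambda>c. hd (h c)) {..<r}"
      by (rule inj_onI) (metis disj_h disjoint_iff hd_in_set lessThan_iff ne_h)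
    moreover have "(\<lambda>c. hd (h c)) ` {..<r} \<subseteq> To_Out s ` {..<k}"
      using hd_h unfolding S_def out_arcs_Orig[OF s] by auto
    ultimately have "card {..<r} \<le> card (To_Out s ` {..<k} :: ('v,'e) split_arc set)" by (intro card_inj_on_le) auto
    also have "\<dots> \<le> k" using card_image_le[of "{..<k}" "To_Out s"] by simp
    finally show ?thesis by simp
  qed
  ultimately show ?thesis using rank_eq unfolding S_def T_def by simp
qed

text \<open>The fixed border cuts out of the block an \<open>r\<close> by \<open>r\<close>
  submatrix; by the Schur complement its determinant is nonzero.\<close>

lemma mat_rank_M_block_ge:
  fixes x :: "(('v,'e) split_arc, 'a::field) sample"
  assumes det: "det (I_minus_RL H k vs es x) \<noteq> 0" and s: "s \<in> verts G" and t: "t \<in> verts G" and r: "r \<le> k"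
    and bordered: "det (bordered_mat H k vs es r s t x) \<noteq> 0"
  shows "r \<le> mat_rank (M_block H k vs es (map Orig us) x (out_arcs H (Orig s)) (in_arcs H (Orig t)))"
proof -
  define S where "S = out_arcs H (Orig s)"
  define T where "T = in_arcs H (Orig t)"
  let ?m = "length es"
  let ?L = "L_mat H k vs es x" and ?R = "R_mat H k vs es x"
  obtain Y where inv: "mat_inverse (I_minus_RL H k vs es x) = Some Y"
    and Y: "Y \<in> carrier_mat (k * length vs) (k * length vs)" and Yinv: "I_minus_RL H k vs es x * Y = 1\<^sub>m (k * length vs)"
    using I_minus_RL_inverse[OF det] by blast
  define Z where "Z = ?L * Y * ?R"
  have Z: "Z \<in> carrier_mat ?m ?m"
    unfolding Z_def by (intro mult_carrier_mat[OF _ R_mat_carrier] mult_carrier_mat[OF L_mat_carrier Y])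
  obtain nr nc \<rho> \<sigma> where M: "M_block H k vs es (map Orig us) x S T = mat nr nc (\<lambda>(i, j). Z $$ (\<rho> i, \<sigma> j))"
    and \<rho>': "\<forall>i<nr. \<rho> i < ?m \<and> es ! \<rho> i \<in> S" and \<sigma>': "\<forall>j<nc. \<sigma> j < ?m \<and> es ! \<sigma> j \<in> T"
    and \<rho>_ex: "\<forall>e \<in> S \<inter> set (out_order H es (map Orig us)). \<exists>i<nr. es ! \<rho> i = e"
    and \<sigma>_ex: "\<forall>e \<in> T \<inter> set (in_order H es (map Orig us)). \<exists>j<nc. es ! \<sigma> j = e"
    using M_block_index[OF inv Y, of "map Orig us" S T, folded Z_def] by blast
  have \<rho>: "\<rho> i < ?m \<and> es ! \<rho> i \<in> S" if "i < nr" for i using \<rho>' that by blast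
  have \<sigma>: "\<sigma> j < ?m \<and> es ! \<sigma> j \<in> T" if "j < nc" for j using \<sigma>' that by blast
  define B where "B = mat nr nc (\<lambda>(i, j). Z $$ (\<rho> i, \<sigma> j))"
  have B: "B \<in> carrier_mat nr nc" unfolding B_def by simp
  have "\<exists>i<nr. es ! \<rho> i = To_Out s c" if "c < r" for c
    by (rule bspec[OF \<rho>_ex]) (use that r s us es in \<open>auto simp: S_def out_arcs_Orig out_order_def H\<close>)
  then obtain \<alpha> where \<alpha>: "\<And>c. c < r \<Longrightarrow> \<alpha> c < nr \<and> es ! \<rho> (\<alpha> c) = To_Out s c" by metis
  have "\<exists>j<nc. es ! \<sigma> j = From_In t c" if "c < r" for c
    by (rule bspec[OF \<sigma>_ex]) (use that r t us es in \<open>auto simp: T_def in_arcs_Orig in_order_def H\<close>)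
  then obtain \<beta> where \<beta>: "\<And>c. c < r \<Longrightarrow> \<beta> c < nc \<and> es ! \<sigma> (\<beta> c) = From_In t c" by metis
  have nth_eq: "es ! a = es ! b \<longleftrightarrow> a = b" if "a < ?m" "b < ?m" for a b
    using es(1) that by (simp add: nth_eq_iff_index_eq)
  define E where "E = (mat r ?m (\<lambda>(c, a). if es ! a = To_Out s c then 1 else 0) :: 'a mat)"
  define F where "F = (mat ?m r (\<lambda>(a, c). if es ! a = From_In t c then 1 else 0) :: 'a mat)"
  have E: "E \<in> carrier_mat r ?m" and F: "F \<in> carrier_mat ?m r" unfolding E_def F_def by auto
  have "es ! a = To_Out s c \<longleftrightarrow> a = \<rho> (\<alpha> c)" if "c < r" "a < ?m" for a c
    using that \<alpha>[of c] \<rho>[of "\<alpha> c"] nth_eq[of a "\<rho> (\<alpha> c)"] by auto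
  then have E_eq: "E = row_selection r ?m (\<rho> \<circ> \<alpha>)"
    unfolding E_def row_selection_def by (intro eq_matI) auto
  have "es ! a = From_In t c \<longleftrightarrow> a = \<sigma> (\<beta> c)" if "c < r" "a < ?m" for a c
    using that \<beta>[of c] \<sigma>[of "\<beta> c"] nth_eq[of a "\<sigma> (\<beta> c)"] by auto
  then have F_eq: "F = col_selection ?m r (\<sigma> \<circ> \<beta>)"
    unfolding F_def col_selection_def by (intro eq_matI) auto
  have EF: "E * F = 0\<^sub>m r r"
    unfolding E_def F_def by (rule eq_matI) (auto simp: scalar_prod_def)
  have "det (E * Z * F) \<noteq> 0"
    using bordered Yinv det_bordered_iff[OF L_mat_carrier R_mat_carrier Y _ E F EF]
    unfolding bordered_mat_def I_minus_RL_def E_def F_def Z_def by blast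
  also have "E * Z * F = mat r r (\<lambda>(c, d). Z $$ (\<rho> (\<alpha> c), \<sigma> (\<beta> d)))"
    unfolding E_eq F_eq using selection_mult[OF Z, of r "\<rho> \<circ> \<alpha>" r "\<sigma> \<circ> \<beta>"] \<alpha> \<beta> \<rho> \<sigma> by simp
  also have "\<dots> = mat r r (\<lambda>(c, d). B $$ (\<alpha> c, \<beta> d))"
    unfolding B_def by (rule cong_mat) (use \<alpha> \<beta> in auto)
  also have "\<dots> = row_selection r nr \<alpha> * B * col_selection nc r \<beta>"
    by (rule selection_mult[OF B, symmetric]) (use \<alpha> \<beta> in auto)
  finally have "r \<le> vec_space.rank nr B"
    by (rule rank_ge_of_det_nonzero[OF B selection_carrier])
  then show ?thesis using B unfolding S_def[symmetric] T_def[symmetric] M B_def[symmetric] mat_rank_def by simp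
qed

text \<open>
  The witness routes the \<open>c\<close>-th of \<open>r\<close> edge-disjoint paths through the \<open>c\<close>-th parallel edges
  and through the \<open>c\<close>-th layer of \<open>L\<close> and \<open>R\<close>, so that \<open>L R\<close> is the successor relation of these
  paths. Each path is cut at its last edge, which matters for the cycles occurring if \<open>s = t\<close>.
\<close>

lemma bordered_mat_witness:
  assumes s: "s \<in> verts G" and t: "t \<in> verts G" and r: "r \<le> k" "r \<le> edge_connectivity G s t"
  obtains x :: "(('v,'e) split_arc, 'a::field) sample" where
    "\<And>z. z \<notin> ({..<k} \<times> arcs H) <+> ({..<k} \<times> arcs H) \<Longrightarrow> x z = 0" "det (bordered_mat H k vs es r s t x) \<noteq> 0"
proof -
  let ?m = "length es"
  obtain P where P: "finite P" "\<forall>p\<in>P. st_path G s p t" "pairwise (\<lambda>p q. set p \<inter> set q = {}) P"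
    "card P = edge_connectivity G s t"
    using edge_connectivity_attained by blast
  obtain q where "bij_betw q {0..<card P} P" using ex_bij_betw_nat_finite[OF P(1)] by blast
  then have q_mem: "q c \<in> P" and q_inj: "d < r \<Longrightarrow> q c = q d \<Longrightarrow> c = d" if "c < r" for c d
    using that r(2) P(4) by (auto simp: bij_betw_def inj_on_def)
  have path: "st_path G s (q c) t" if "c < r" for c using P(2) q_mem[OF that] by blast
  note q_dist = st_path_distinct[OF wf_digraph_axioms path]
  have q_arcs: "q c \<noteq> []" "set (q c) \<subseteq> arcs G" if "c < r" for c using st_path_arcs[OF path[OF that]] by auto
  have q_disj: "set (q c) \<inter> set (q d) = {}" if "c < r" "d < r" "c \<noteq> d" for c d
    using P(3) q_mem[OF that(1)] q_mem[OF that(2)] q_inj[OF that(1,2)] that(3) unfolding pairwise_def by blast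
  \<comment> \<open>Path \<open>c\<close> lifted to the auxiliary graph. The index \<open>c\<close>
    on the parallel edges keeps lifts disjoint even where the paths share vertices.\<close>
  define A :: "nat \<Rightarrow> ('v,'e) split_arc set" where
    "A c = (\<Union>a\<in>set (q c). {To_Out (tail G a) c, Old_Arc a, From_In (head G a) c})" for c
  have A_disj: "A c \<inter> A d = {}" if "c < r" "d < r" "c \<noteq> d" for c d
    using q_disj[OF that] that(3) unfolding A_def by blast
  have A_arcs: "A c \<subseteq> arcs H" if "c < r" for c
    using q_arcs(2)[OF that] that r(1) unfolding A_def H by auto
  \<comment> \<open>\<open>L\<close> is zero on edges into \<open>Orig t\<close>. So the row of
    \<open>K\<close> at \<open>From_In t c\<close> vanishes, and for s = t the lifted cycle is not
    closed up.\<close>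
  define x :: "(('v,'e) split_arc, 'a) sample" where
    "x z = (case z of Inl (i, e) \<Rightarrow> if i < r \<and> e \<in> A i \<and> head H e \<noteq> Orig t then 1 else 0
                    | Inr (i, e) \<Rightarrow> if i < r \<and> e \<in> A i then 1 else 0)" for z
  have supp: "x z = 0" if "z \<notin> ({..<k} \<times> arcs H) <+> ({..<k} \<times> arcs H)" for z
    using that r(1) A_arcs by (auto simp: x_def split: sum.splits prod.splits)
  define K where "K = L_mat H k vs es x * R_mat H k vs es x"
  have K: "K \<in> carrier_mat ?m ?m" unfolding K_def by (rule mult_carrier_mat[OF L_mat_carrier R_mat_carrier])
  have K_index: "K $$ (a, b) = (if head H (es ! a) = tail H (es ! b) \<and> head H (es ! a) \<noteq> Orig t \<and> es ! b \<in> A c then 1 else 0)"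
    if c: "c < r" and a: "a < ?m" "es ! a \<in> A c" and b: "b < ?m" for a b c
  proof -
    \<comment> \<open>Since the lifts are disjoint, an edge of lift \<open>c\<close> sees layer
      \<open>c\<close> only.\<close>
    have "es ! a \<in> A i \<longleftrightarrow> i = c" if "i < r" for i using A_disj[OF that c] a(2) by blast
    then have "(\<Sum>i<k. x (Inl (i, es ! a)) * x (Inr (i, es ! b)))
        = (\<Sum>i<k. if i = c then if head H (es ! a) \<noteq> Orig t \<and> es ! b \<in> A c then 1 else 0 else 0)"
      using c by (intro sum.cong) (auto simp: x_def)
    then show ?thesis unfolding K_def LR_index'[OF a(1) a(1) b] using c r(1) by simp
  qed
  have K_zero: "K $$ (a, b) = 0" if "a < ?m" "b < ?m" "head H (es ! a) = Orig t \<or> (\<forall>c<r. es ! a \<notin> A c)" for a b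
    unfolding K_def LR_index'[OF that(1,1,2)] using that(3) by (auto simp: x_def intro!: sum.neutral)
  define F where "F = (mat ?m r (\<lambda>(a, c). if es ! a = From_In t c then 1 else 0) :: 'a mat)"
  define E where "E = (mat r ?m (\<lambda>(c, a). if es ! a = To_Out s c then 1 else 0) :: 'a mat)"
  have F: "F \<in> carrier_mat ?m r" and E: "E \<in> carrier_mat r ?m" unfolding E_def F_def by auto
  have "\<forall>e\<in>arcs H. \<exists>a<?m. es ! a = e" using es(2) by (metis in_set_conv_nth)
  then obtain idx where idx: "\<And>e. e \<in> arcs H \<Longrightarrow> idx e < ?m \<and> es ! idx e = e" by metis
  have idx_eq: "es ! a = e \<longleftrightarrow> a = idx e" if "a < ?m" "e \<in> arcs H" for a e
    using idx[OF that(2)] nth_eq_iff_index_eq[OF es(1) that(1), of "idx e"] by auto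
  \<comment> \<open>Nonsingularity is shown by a trivial kernel: the lower rows force zeros on the
    first edges, the upper rows carry them along each lifted path, and the rows of the last edges
    then force \<open>v = 0\<close>.\<close>
  have "det (four_block_mat (1\<^sub>m ?m - K) F E (0\<^sub>m r r)) \<noteq> 0"
  proof (subst det_nonzero_iff_inj)
    show "four_block_mat (1\<^sub>m ?m - K) F E (0\<^sub>m r r) \<in> carrier_mat (?m + r) (?m + r)"
      using minus_carrier_mat[OF K, of "1\<^sub>m ?m"] by auto
    show "\<forall>V\<in>carrier_vec (?m + r). four_block_mat (1\<^sub>m ?m - K) F E (0\<^sub>m r r) *\<^sub>v V = 0\<^sub>v (?m + r) \<longrightarrow> V = 0\<^sub>v (?m + r)"
    proof (intro ballI impI)
      fix V :: "'a vec"
      assume V: "V \<in> carrier_vec (?m + r)"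
        and NV: "four_block_mat (1\<^sub>m ?m - K) F E (0\<^sub>m r r) *\<^sub>v V = 0\<^sub>v (?m + r)"
      define u where "u = vec_first V ?m"
      define v where "v = vec_last V r"
      have u: "u \<in> carrier_vec ?m" and v: "v \<in> carrier_vec r" and V_eq: "V = u @\<^sub>v v"
        unfolding u_def v_def using V by auto
      have top_carrier: "(1\<^sub>m ?m - K) *\<^sub>v u + F *\<^sub>v v \<in> carrier_vec ?m"
        using F K u v by (intro add_carrier_vec mult_mat_vec_carrier[OF minus_carrier_mat]) auto
      have "((1\<^sub>m ?m - K) *\<^sub>v u + F *\<^sub>v v) @\<^sub>v (E *\<^sub>v u + 0\<^sub>m r r *\<^sub>v v) = 0\<^sub>v ?m @\<^sub>v 0\<^sub>v r"
        using NV unfolding V_eq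
        by (subst (asm) four_block_mat_mult_vec[OF minus_carrier_mat[OF K] F E zero_carrier_mat u v]) auto
      then have top: "(1\<^sub>m ?m - K) *\<^sub>v u + F *\<^sub>v v = 0\<^sub>v ?m" and bot: "E *\<^sub>v u + 0\<^sub>m r r *\<^sub>v v = 0\<^sub>v r"
        using append_vec_eq[OF top_carrier zero_carrier_vec] by blast+
      have row: "u $ a = (\<Sum>b = 0..<?m. K $$ (a, b) * u $ b) - (\<Sum>c = 0..<r. if es ! a = From_In t c then v $ c else 0)"
        if a: "a < ?m" for a
      proof -
        have "((1\<^sub>m ?m - K) *\<^sub>v u) $ a = u $ a - (\<Sum>b = 0..<?m. K $$ (a, b) * u $ b)"
          using a u K by (simp add: minus_mult_distrib_mat_vec[OF one_carrier_mat K u] scalar_prod_def)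
        moreover have "(F *\<^sub>v v) $ a = (\<Sum>c = 0..<r. if es ! a = From_In t c then v $ c else 0)"
          using a v by (simp add: F_def scalar_prod_def if_distrib[of "\<lambda>y. y * _"] cong: if_cong)
        moreover have "((1\<^sub>m ?m - K) *\<^sub>v u) $ a + (F *\<^sub>v v) $ a = 0"
          using arg_cong[OF top, of "\<lambda>w. w $ a"] a F by simp
        ultimately have "u $ a - (\<Sum>b = 0..<?m. K $$ (a, b) * u $ b)
            + (\<Sum>c = 0..<r. if es ! a = From_In t c then v $ c else 0) = 0" by simp
        moreover have "y = z - w" if "y - z + w = 0" for y z w :: 'a
          using arg_cong[OF that, of "\<lambda>q. q + (z - w)"] by simp
        ultimately show ?thesis by blast
      qed
      define U where "U e = u $ idx e" for e
      have U_first: "U (To_Out s c) = 0" if c: "c < r" for c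
      proof -
        have e: "To_Out s c \<in> arcs H" using s c r(1) unfolding H by simp
        have "0 = (E *\<^sub>v u) $ c" using arg_cong[OF bot, of "\<lambda>w. w $ c"] c E v by simp
        also have "\<dots> = (\<Sum>a = 0..<?m. if a = idx (To_Out s c) then u $ a else 0)"
          using c u by (auto simp: E_def scalar_prod_def idx_eq[OF _ e] if_distrib[of "\<lambda>y. y * _"] cong: if_cong)
        also have "\<dots> = U (To_Out s c)" using idx[OF e] unfolding U_def by simp
        finally show ?thesis by simp
      qed
      \<comment> \<open>Row \<open>e\<close> of the kernel equation contains only \<open>e\<close>
        and its successor \<open>f\<close>; the border \<open>F\<close> does not meet it, as
        \<open>head H e \<noteq> Orig t\<close>.\<close>
      have U_succ: "U e = U f"
        if c: "c < r" and e: "e \<in> A c" "head H e \<noteq> Orig t" and f: "f \<in> A c" "tail H f = head H e"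
          and uniq: "\<And>f'. f' \<in> A c \<Longrightarrow> tail H f' = head H e \<Longrightarrow> f' = f" for c e f
      proof -
        have eH: "e \<in> arcs H" and fH: "f \<in> arcs H" using A_arcs[OF c] e f by auto
        have "U e = (\<Sum>b = 0..<?m. K $$ (idx e, b) * u $ b)"
          unfolding U_def using row[of "idx e"] idx[OF eH] e(2) by (auto simp: H intro!: sum.neutral)
        also have "\<dots> = (\<Sum>b = 0..<?m. if b = idx f then u $ b else 0)"
        proof (rule sum.cong)
          fix b assume "b \<in> {0..<?m}"
          then have b: "b < ?m" by simp
          have "head H e = tail H (es ! b) \<and> es ! b \<in> A c \<longleftrightarrow> b = idx f"
            using uniq[of "es ! b"] f idx_eq[OF b fH] by auto
          then show "K $$ (idx e, b) * u $ b = (if b = idx f then u $ b else 0)"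
            using K_index[OF c _ _ b, of "idx e"] idx[OF eH] e by auto
        qed simp
        also have "\<dots> = U f" unfolding U_def using idx[OF fH] by simp
        finally show ?thesis .
      qed
      \<comment> \<open>The path ends here: the row of \<open>K\<close> is zero and only the border
        entry remains.\<close>
      have U_last: "U (From_In t c) = - v $ c" if c: "c < r" for c
      proof -
        have e: "From_In t c \<in> arcs H" using t c r(1) unfolding H by simp
        have "(\<Sum>b = 0..<?m. K $$ (idx (From_In t c), b) * u $ b) = 0"
          using K_zero[of "idx (From_In t c)"] idx[OF e] by (auto simp: H intro!: sum.neutral)
        then show ?thesis unfolding U_def using row[of "idx (From_In t c)"] idx[OF e] c by simp
      qed
      have path_zero: "U e = 0" if c: "c < r" and e: "e \<in> A c" for c e
      proof -
        let ?q = "q c"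
        have head_eq: "head H (From_In w d) = Orig w" "head H (To_Out w d) = Out w" "head H (Old_Arc a) = In (head G a)"
          for w d a unfolding H by auto
        have inj: "a = b" if "a \<in> set ?q" "b \<in> set ?q" "tail G a = tail G b" for a b
          using q_dist(1)[OF c] that by (auto simp: distinct_map inj_on_def)
        have step: "U (To_Out (tail G a) c) = U (Old_Arc a)" "U (Old_Arc a) = U (From_In (head G a) c)"
          if a: "a \<in> set ?q" for a
        proof -
          show "U (To_Out (tail G a) c) = U (Old_Arc a)"
            by (rule U_succ[OF c]) (use a inj in \<open>auto simp: A_def H\<close>)
          show "U (Old_Arc a) = U (From_In (head G a) c)"
            by (rule U_succ[OF c]) (use a in \<open>auto simp: A_def H\<close>)
        qed
        have "n < length ?q \<Longrightarrow> U (To_Out (tail G (?q ! n)) c) = 0" for n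
        proof (induct n)
          case 0
          then show ?case using q_dist(2)[OF c] U_first[OF c] by (simp add: hd_conv_nth)
        next
          case (Suc n)
          let ?a = "?q ! n" and ?b = "?q ! Suc n"
          have mem: "?a \<in> set ?q" "?b \<in> set ?q" using Suc.prems by auto
          have ab: "head G ?a = tail G ?b"
            using q_dist(5)[OF c] Suc.prems by (simp add: successively_conv_nth)
          have "?b \<in> set (tl ?q)" using Suc.prems by (metis Suc_less_eq length_Cons list.collapse list.sel(2) list.size(3) not_less_zero nth_Cons_Suc nth_mem)
          \<comment> \<open>The cut at \<open>Orig t\<close> must not interrupt the chain. For s = t
            the first edge does have tail \<open>t\<close>, but \<open>?b\<close> is a later
            edge.\<close>
          then have "tail G ?b \<noteq> t" using q_dist(4)[OF c] by auto
          moreover have "From_In (head G ?a) c \<in> A c" "To_Out (tail G ?b) c \<in> A c"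
            using mem unfolding A_def by blast+
          ultimately have "U (From_In (head G ?a) c) = U (To_Out (tail G ?b) c)"
            by (intro U_succ[OF c]) (use ab in \<open>auto simp: A_def H\<close>)
          then show ?case using Suc step[OF mem(1)] by simp
        qed
        then have "U (To_Out (tail G a) c) = 0" if "a \<in> set ?q" for a using that by (metis in_set_conv_nth)
        then show ?thesis using e step unfolding A_def by auto
      qed
      have v_zero: "v $ c = 0" if c: "c < r" for c
      proof -
        have "From_In t c \<in> A c"
          using q_dist(3)[OF c] q_arcs(1)[OF c] last_in_set unfolding A_def by fastforce
        then show ?thesis using U_last[OF c] path_zero[OF c] by simp
      qed
      \<comment> \<open>Edges on no lift have a zero row in \<open>K\<close>, so their coordinate is
        determined by \<open>v\<close> alone.\<close>
      have u_zero: "u $ a = 0" if a: "a < ?m" for a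
      proof (cases "\<exists>c<r. es ! a \<in> A c")
        case True
        then obtain c where c: "c < r" "es ! a \<in> A c" by blast
        have "es ! a \<in> arcs H" using a es(2) nth_mem by blast
        then have "a = idx (es ! a)" using idx_eq[OF a] by blast
        then show ?thesis using path_zero[OF c] unfolding U_def by simp
      next
        case False
        then show ?thesis using row[OF a] K_zero[OF a] v_zero by (auto intro!: sum.neutral)
      qed
      show "V = 0\<^sub>v (?m + r)"
        unfolding V_eq using u v u_zero v_zero by (intro eq_vecI) auto
    qed
  qed
  then have "det (bordered_mat H k vs es r s t x) \<noteq> 0"
    unfolding bordered_mat_def K_def E_def F_def .
  then show thesis using that supp by blast
qed

subsection \<open>Failure probability\<close>

lemma line_degree_le_L: "a < length es \<Longrightarrow> q < k * length vs \<Longrightarrow>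
    line_degree_le 1 (\<lambda>x :: (('v,'e) split_arc, 'a::field) sample. L_mat H k vs es x $$ (a, q))"
  unfolding L_mat_index by (cases "head H (es ! a) = vs ! (q mod length vs)")
    (simp_all only: simp_thms if_True if_False line_degree_le_coord line_degree_le_const)

lemma line_degree_le_R: "a < length es \<Longrightarrow> q < k * length vs \<Longrightarrow>
    line_degree_le 1 (\<lambda>x :: (('v,'e) split_arc, 'a::field) sample. R_mat H k vs es x $$ (q, a))"
  unfolding R_mat_index by (cases "tail H (es ! a) = vs ! (q mod length vs)")
    (simp_all only: simp_thms if_True if_False line_degree_le_coord line_degree_le_const)

lemma line_degree_le_det_I_minus_RL:
  "line_degree_le (k * length vs * 2) (\<lambda>x :: (('v,'e) split_arc, 'a::field) sample. det (I_minus_RL H k vs es x))"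
proof (rule line_degree_le_det[OF I_minus_RL_carrier])
  fix i j assume ij: "i < k * length vs" "j < k * length vs"
  have "I_minus_RL H k vs es x $$ (i, j) = 1\<^sub>m (k * length vs) $$ (i, j)
      - (\<Sum>a = 0..<length es. R_mat H k vs es x $$ (i, a) * L_mat H k vs es x $$ (a, j))"
    for x :: "(('v,'e) split_arc, 'a) sample"
    unfolding I_minus_RL_def using ij carrier_matD[OF L_mat_carrier[of H k vs es x]] carrier_matD[OF R_mat_carrier[of H k vs es x]]
    by (simp add: scalar_prod_def)
  moreover have "line_degree_le 2 (\<lambda>x :: (('v,'e) split_arc, 'a) sample. R_mat H k vs es x $$ (i, a) * L_mat H k vs es x $$ (a, j))"
    if "a \<in> {0..<length es}" for a
    using line_degree_le_mult[OF line_degree_le_R line_degree_le_L, of a i a j] ij that by (simp add: numeral_2_eq_2)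
  ultimately show "line_degree_le 2 (\<lambda>x :: (('v,'e) split_arc, 'a) sample. I_minus_RL H k vs es x $$ (i, j))"
    by (simp only:) (intro line_degree_le_diff line_degree_le_sum line_degree_le_const; simp)
qed

lemma bordered_mat_carrier: "bordered_mat H k vs es r s t x \<in> carrier_mat (length es + r) (length es + r)"
  unfolding bordered_mat_def
  using minus_carrier_mat[OF mult_carrier_mat[OF L_mat_carrier[of H k vs es x] R_mat_carrier[of H k vs es x]], of "1\<^sub>m (length es)"]
  by auto

lemma bordered_mat_index:
  assumes "i < length es + r" "j < length es + r"
  shows "bordered_mat H k vs es r s t x $$ (i, j) =
    (if i < length es \<and> j < length es then 1\<^sub>m (length es) $$ (i, j)
        - (\<Sum>q = 0..<k * length vs. L_mat H k vs es x $$ (i, q) * R_mat H k vs es x $$ (q, j))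
     else if i < length es then if es ! i = From_In t (j - length es) then 1 else 0
     else if j < length es then if es ! j = To_Out s (i - length es) then 1 else 0
     else 0)"
proof -
  have K: "L_mat H k vs es x * R_mat H k vs es x \<in> carrier_mat (length es) (length es)"
    by (rule mult_carrier_mat[OF L_mat_carrier R_mat_carrier])
  define A where "A = 1\<^sub>m (length es) - L_mat H k vs es x * R_mat H k vs es x"
  have A: "A \<in> carrier_mat (length es) (length es)" unfolding A_def by (rule minus_carrier_mat[OF K])
  have "A $$ (i, j) = 1\<^sub>m (length es) $$ (i, j)
        - (\<Sum>q = 0..<k * length vs. L_mat H k vs es x $$ (i, q) * R_mat H k vs es x $$ (q, j))"
    if "i < length es" "j < length es"
    unfolding A_def using that carrier_matD[OF L_mat_carrier[of H k vs es x]] carrier_matD[OF R_mat_carrier[of H k vs es x]]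
    by (simp add: scalar_prod_def)
  then show ?thesis unfolding bordered_mat_def A_def[symmetric] using assms A by auto
qed

lemma line_degree_le_det_bordered_mat:
  "line_degree_le ((length es + r) * 2) (\<lambda>x :: (('v,'e) split_arc, 'a::field) sample. det (bordered_mat H k vs es r s t x))"
proof (rule line_degree_le_det[OF bordered_mat_carrier])
  fix i j assume ij: "i < length es + r" "j < length es + r"
  show "line_degree_le 2 (\<lambda>x :: (('v,'e) split_arc, 'a) sample. bordered_mat H k vs es r s t x $$ (i, j))"
  proof (cases "i < length es \<and> j < length es")
    case True
    have "line_degree_le 2 (\<lambda>x :: (('v,'e) split_arc, 'a) sample. L_mat H k vs es x $$ (i, q) * R_mat H k vs es x $$ (q, j))"
      if "q \<in> {0..<k * length vs}" for q
      using line_degree_le_mult[OF line_degree_le_L line_degree_le_R, of i q j q] True that by (simp add: numeral_2_eq_2)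
    then show ?thesis
      unfolding bordered_mat_index[OF ij] if_P[OF True]
      by (intro line_degree_le_diff line_degree_le_sum line_degree_le_const) simp_all
  next
    case False
    show ?thesis unfolding bordered_mat_index[OF ij] if_not_P[OF False]
      by (rule line_degree_le_const)
  qed
qed

text \<open>At the zero sample the matrix is the identity, so this sample is the required nonzero of
  the determinant.\<close>

lemma prob_det_I_minus_RL_zero:
  "measure_pmf.prob (random_sample H k)
      {x :: (('v,'e) split_arc, 'p::prime_card mod_ring) sample. det (I_minus_RL H k vs es x) = 0}
    \<le> real (k * length vs * 2) / (real CARD('p) - 1)"
proof -
  let ?x0 = "(\<lambda>_. 0) :: (('v,'e) split_arc, 'p mod_ring) sample"
  have "I_minus_RL H k vs es ?x0 = 1\<^sub>m (k * length vs)"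
    using carrier_matD[OF I_minus_RL_carrier[of H k vs es ?x0]]
    unfolding I_minus_RL_def
    using carrier_matD[OF L_mat_carrier[of H k vs es ?x0]] carrier_matD[OF R_mat_carrier[of H k vs es ?x0]]
    by (intro eq_matI) (auto simp: scalar_prod_def L_mat_index intro!: sum.neutral)
  then have "det (I_minus_RL H k vs es ?x0) \<noteq> 0" by simp
  moreover have "finite (({..<k} \<times> arcs H) <+> ({..<k} \<times> arcs H))" by (simp flip: es(2))
  ultimately show ?thesis
    unfolding random_sample_def using prob_zero_le[OF _ line_degree_le_det_I_minus_RL, of _ ?x0, unfolded CARD_mod_ring] by blast
qed

lemma prob_det_bordered_mat_zero:
  assumes "s \<in> verts G" "t \<in> verts G" "r \<le> k" "r \<le> edge_connectivity G s t"
  shows "measure_pmf.prob (random_sample H k)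
      {x :: (('v,'e) split_arc, 'p::prime_card mod_ring) sample. det (bordered_mat H k vs es r s t x) = 0}
    \<le> real ((length es + r) * 2) / (real CARD('p) - 1)"
proof -
  obtain x :: "(('v,'e) split_arc, 'p mod_ring) sample" where
    "\<And>z. z \<notin> ({..<k} \<times> arcs H) <+> ({..<k} \<times> arcs H) \<Longrightarrow> x z = 0" "det (bordered_mat H k vs es r s t x) \<noteq> 0"
    using bordered_mat_witness[OF assms] by blast
  moreover have "finite (({..<k} \<times> arcs H) <+> ({..<k} \<times> arcs H))" by (simp flip: es(2))
  ultimately show ?thesis
    unfolding random_sample_def using prob_zero_le[OF _ line_degree_le_det_bordered_mat, where a = x, unfolded CARD_mod_ring] by blast
qed

end

theorem theorem11:
  fixes G :: "('v,'e) pre_digraph"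
    and k :: nat
    and H :: "('v split_vertex, ('v,'e) split_arc) pre_digraph"
    and us :: "'v list"
    and vs :: "'v split_vertex list"
    and es :: "('v,'e) split_arc list"
  assumes "fin_digraph G" and "loopfree_digraph G"
    and "k > 0"
    and "H = split_graph k G"
    and "distinct us" and "set us = verts G"
    and "distinct vs" and "set vs = verts H"
    and "distinct es" and "set es = arcs H"
    and "CARD('p::prime_card) \<ge> 2 * card (arcs H) ^ 5"
  shows "measure_pmf.prob (random_sample H k)
           {x :: (('v,'e) split_arc, 'p mod_ring) sample.
              invertible_mat (I_minus_RL H k vs es x) \<and>
              (\<forall>s\<in>verts G. \<forall>t\<in>verts G.
                 mat_rank (M_block H k vs es (map Orig us) x
                             (out_arcs H (Orig s)) (in_arcs H (Orig t)))
                 = min k (edge_connectivity G s t))}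
         \<ge> 1 - 5 / real (card (arcs H))"
proof -
  interpret fin_digraph G by fact
  interpret loopfree_digraph G by fact
  interpret split_matrices G k H us vs es
    using assms by unfold_locales auto
  define m where "m = card (arcs H)"
  define n where "n = card (verts G)"
  define r where "r = (\<lambda>(s, t). min k (edge_connectivity G s t))"
  have len_es: "length es = m" unfolding m_def using assms distinct_card by metis
  have len_vs: "length vs = 3 * n" unfolding n_def
    using assms distinct_card[of vs] card_verts_split_graph[OF \<open>fin_digraph G\<close>, of k] by simp
  have m: "m = card (arcs G) + 2 * k * n"
    unfolding m_def n_def assms(4) by (rule card_arcs_split_graph[OF \<open>fin_digraph G\<close>])
  define good where "good = {x :: (('v,'e) split_arc, 'p mod_ring) sample.
      invertible_mat (I_minus_RL H k vs es x) \<and>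
      (\<forall>s\<in>verts G. \<forall>t\<in>verts G. mat_rank (M_block H k vs es (map Orig us) x (out_arcs H (Orig s)) (in_arcs H (Orig t)))
         = min k (edge_connectivity G s t))}"
  define bad0 where "bad0 = {x :: (('v,'e) split_arc, 'p mod_ring) sample. det (I_minus_RL H k vs es x) = 0}"
  define bad where "bad st = {x :: (('v,'e) split_arc, 'p mod_ring) sample.
      det (bordered_mat H k vs es (r st) (fst st) (snd st) x) = 0}" for st
  let ?V = "verts G \<times> verts G"
  let ?D = "random_sample H k :: (('v,'e) split_arc, 'p mod_ring) sample pmf"
  have good: "- (bad0 \<union> (\<Union>st\<in>?V. bad st)) \<subseteq> good"
  proof
    fix x assume x: "x \<in> - (bad0 \<union> (\<Union>st\<in>?V. bad st))"
    then have det: "det (I_minus_RL H k vs es x) \<noteq> 0" by (simp add: bad0_def)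
    have "mat_rank (M_block H k vs es (map Orig us) x (out_arcs H (Orig s)) (in_arcs H (Orig t))) = r (s, t)"
      if st: "s \<in> verts G" "t \<in> verts G" for s t
    proof (rule antisym)
      show "r (s, t) \<le> mat_rank (M_block H k vs es (map Orig us) x (out_arcs H (Orig s)) (in_arcs H (Orig t)))"
        by (rule mat_rank_M_block_ge[OF det st]) (use x st in \<open>auto simp: r_def bad_def\<close>)
    qed (use mat_rank_M_block_le[OF det st] in \<open>simp add: r_def\<close>)
    then show "x \<in> good" using I_minus_RL_inverse[OF det] unfolding good_def r_def by auto
  qed
  have prob_good: "measure_pmf.prob ?D good \<ge> 1 - measure_pmf.prob ?D (bad0 \<union> (\<Union>st\<in>?V. bad st))"
    using measure_pmf.finite_measure_mono[OF good, of ?D] measure_pmf.prob_compl[of "bad0 \<union> (\<Union>st\<in>?V. bad st)" ?D]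
    by (simp add: Compl_eq_Diff_UNIV)
  have "measure_pmf.prob ?D (bad0 \<union> (\<Union>st\<in>?V. bad st)) \<le> 5 / real m"
  proof (cases "m = 0")
    case True
    \<comment> \<open>Here \<open>5 / real m\<close> is 0 by the convention for division by zero, so
      the failure probability itself has to be 0: there are no pairs, and a 0 by 0 determinant is
      1.\<close>
    then have "n = 0" using m \<open>k > 0\<close> by simp
    then have "verts G = {}" "length vs = 0" using len_vs unfolding n_def by auto
    moreover have "bad0 = {}"
    proof -
      have "det (I_minus_RL H k vs es x) = 1" for x :: "(('v,'e) split_arc, 'p mod_ring) sample"
        using I_minus_RL_carrier[of H k vs es x] \<open>length vs = 0\<close> by (simp add: det_dim_zero)
      then show ?thesis unfolding bad0_def by simp
    qed
    ultimately show ?thesis using True by simp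
  next
    case False
    define P where "P = real CARD('p) - 1"
    \<comment> \<open>One of the two copies of \<open>m ^ 5\<close> in the bound on the prime
      absorbs the -1 of \<open>P\<close>.\<close>
    have "1 \<le> m ^ 5" using False by simp
    then have "real (m ^ 5) + 1 \<le> real CARD('p)" using assms(11) unfolding m_def[symmetric] by linarith
    then have P: "real m ^ 5 \<le> P" unfolding P_def by simp
    have "0 < P" using P False by (smt (verit) of_nat_0_less_iff not_gr_zero zero_less_power)
    have "measure_pmf.prob ?D (bad0 \<union> (\<Union>st\<in>?V. bad st))
        \<le> measure_pmf.prob ?D bad0 + measure_pmf.prob ?D (\<Union>st\<in>?V. bad st)"
      by (rule measure_Un_le) auto
    also have "measure_pmf.prob ?D (\<Union>st\<in>?V. bad st) \<le> (\<Sum>st\<in>?V. measure_pmf.prob ?D (bad st))"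
      by (rule measure_UNION_le) auto
    also have "\<dots> \<le> (\<Sum>st\<in>?V. real (2 * (m + k)) / P)"
    proof (rule sum_mono)
      fix st assume "st \<in> ?V"
      then obtain s t where st: "st = (s, t)" "s \<in> verts G" "t \<in> verts G" by auto
      have "measure_pmf.prob ?D (bad st) \<le> real ((m + r st) * 2) / P"
        using prob_det_bordered_mat_zero[OF st(2,3), of "r st", where ?'p = 'p] st
        unfolding bad_def P_def len_es by (simp add: r_def)
      also have "\<dots> \<le> real (2 * (m + k)) / P"
        using \<open>0 < P\<close> by (intro divide_right_mono) (auto simp: r_def split: prod.splits)
      finally show "measure_pmf.prob ?D (bad st) \<le> real (2 * (m + k)) / P" .
    qed
    also have "\<dots> = real (n * n * (2 * (m + k))) / P"
      by (simp add: n_def card_cartesian_product)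
    also have "measure_pmf.prob ?D bad0 \<le> real (k * length vs * 2) / P"
      using prob_det_I_minus_RL_zero[where ?'p = 'p] unfolding bad0_def P_def .
    also have "real (k * length vs * 2) / P + real (n * n * (2 * (m + k))) / P
        = real (k * length vs * 2 + n * n * (2 * (m + k))) / P"
      by (simp add: add_divide_distrib)
    also have "\<dots> \<le> real (5 * m ^ 4) / P"
    proof (rule divide_right_mono)
      have "n * n * (2 * (m + k)) \<le> m ^ 3 * 2"
      proof (cases "n = 0")
        case n: False
        \<comment> \<open>All three bounds by \<open>m\<close> come from
          \<open>m \<ge> 2 * k * n\<close>; bounding \<open>k\<close> this way requires a
          vertex.\<close>
        have "n \<le> k * n" "k \<le> k * n" using n \<open>k > 0\<close> by auto
        then have "n \<le> m" "k \<le> m" "2 * n \<le> m" using m by linarith+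
        then have "n * (2 * n) * (m + k) \<le> m * m * (m + m)" by (intro mult_le_mono) auto
        then show ?thesis by (simp add: power3_eq_cube algebra_simps)
      qed simp
      \<comment> \<open>The left side is 6kn, three times the number 2kn of added parallel
        edges.\<close>
      moreover have "k * length vs * 2 \<le> 3 * m" using m unfolding len_vs by (simp add: algebra_simps)
      moreover have "m \<le> m ^ 4" "m ^ 3 \<le> m ^ 4" using False by (auto intro!: power_increasing self_le_power)
      ultimately have "k * length vs * 2 + n * n * (2 * (m + k)) \<le> 5 * m ^ 4" by linarith
      then show "real (k * length vs * 2 + n * n * (2 * (m + k))) \<le> real (5 * m ^ 4)" by (simp only: of_nat_le_iff)
    qed (use \<open>0 < P\<close> in simp)
    also have "\<dots> \<le> real (5 * m ^ 4) / real m ^ 5"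
      using P False \<open>0 < P\<close> by (intro divide_left_mono) auto
    also have "\<dots> = 5 / real m" using False by (simp add: field_simps eval_nat_numeral)
    finally show ?thesis by simp
  qed
  then show ?thesis using prob_good unfolding good_def m_def by linarith
qed

end
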